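(* Let $p\ge 3$ be a prime, let $N$ be a positive integer coprime to $p$, and let $\alpha\ge 0$ be an integer. (1) If $p\equiv 1 \pmod 3$, then $\overline{p}(3p^{6\alpha+5}N)\equiv 0 \pmod 3$ and $\overline{p}(3p^{18\alpha+17}N)\equiv 0 \pmod 9$. (2) If $p\equiv 2 \pmod 3$, then $\overline{p}(3p^{4\alpha+3}N)\equiv 0 \pmod 9$.
   Context: An overpartition of a nonnegative integer $n$ is a partition of $n$ in which the first occurrence of each distinct part may (or may not) be overlined; $\overline{p}(n)$ denotes the number of overpartitions of $n$ (with $\overline{p}(0)=1$). Equivalently, $\sum_{n\ge0}\overline{p}(n)q^n=\prod_{k\ge1}\frac{1+q^k}{1-q^k}$. *)

theory Defs
  imports Main "HOL-Library.Multiset" "HOL-Computational_Algebra.Primes"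
begin

text \<open>An overpartition of n: a partition of n (a multiset of positive parts summing to n)
together with the set of distinct parts whose first occurrence is overlined.\<close>

definition overpartitions :: "nat \<Rightarrow> (nat multiset \<times> nat set) set" where
  "overpartitions n = {(M, S). (\<forall>k\<in>#M. 0 < k) \<and> sum_mset M = n \<and> S \<subseteq> set_mset M}"

definition overpartition_count :: "nat \<Rightarrow> nat" where
  "overpartition_count n = card (overpartitions n)"

end

theory Submission
  imports Defs
    "HOL-Computational_Algebra.Formal_Power_Series"
    "HOL-Number_Theory.Cong"
    "Jordan_Normal_Form.Determinant"
begin

text \<open>
  Let \<open>\<theta> = \<Sum>\<^sub>x q\<^bsup>x\<^sup>2\<^esup>\<close>, summed over the integers. By Gauss, \<open>\<theta>\<close> is the inverse of the series with
  coefficients \<open>(-1)\<^sup>n\<close> times the overpartition numbers. Splitting \<open>\<theta>\<close> by residues modulo 3 and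
  using the \<open>3\<close>-scaled isometry between \<open>\<int>\<^sup>4\<close> and the lattice of the tetracode, the coefficients at
  multiples of 3 form the series \<open>\<theta>(q\<^sup>3)\<^sup>3 / \<theta>(q)\<^sup>4\<close>, which is congruent to \<open>\<theta>\<^sup>5\<close> modulo 9. So, up to
  sign and modulo 9, the number of overpartitions of \<open>3n\<close> is the number \<open>r(n)\<close> of representations of
  \<open>n\<close> as a sum of five squares.

  By Hermite's bound every unimodular lattice of rank at most 5 is isometric to some \<open>\<int>\<^sup>n\<close>; in
  particular this holds for the \<open>p\<close>-neighbours of \<open>\<int>\<^sup>5\<close>, which are indexed by the isotropic lines
  modulo \<open>p\<close>. Counting the vectors of norm \<open>k\<close> (with \<open>p\<close> dividing \<open>k\<close>) in all neighbours in two ways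
  shows that passing from \<open>k\<close> to \<open>p\<^sup>2k\<close> multiplies by \<open>p\<^sup>3\<close> the number of representations that do not
  vanish modulo \<open>p\<close>. Hence \<open>r(p\<^bsup>2j+1\<^esup>N) = r(pN) (1 + p\<^sup>3 + \<dots> + p\<^bsup>3j\<^esup>)\<close> for \<open>N\<close> coprime to \<open>p\<close>, and
  \<open>p\<^sup>3\<close> is \<open>\<plusminus>1\<close> modulo 9.
\<close>

section \<open>Gauss' identity for overpartitions\<close>

text \<open>The exponent 5 is 9 - 4: F(q)^3 and F(q^3) agree modulo 3, and cubing turns this into
  agreement of theta(q)^9 and theta(q^3)^3 modulo 9. The isometry with the standard lattice makes
  all neighbours have the same representation numbers, so a Hecke-type relation for sums of five
  squares comes out of finite counting, without modular forms. Everything stays over the integers: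
  neighbours are scaled by p, Schur complements by the corner entry. The obstacle is that r(p^2 k)
  is not a multiple of r(k). The clean factor p^3 holds only for vectors that do not vanish modulo
  p, and only when p divides k: such a vector is then isotropic modulo p, and the number of
  isotropic lines not orthogonal to it does not depend on the vector. Hence the recursion starts at
  pN and reaches only odd exponents 2j + 1. Finally p^3 is 1 modulo 9 if p is 1 modulo 3, and -1 if
  p is 2 modulo 3. In the first case the geometric sum is j + 1 modulo 9; in the second it vanishes
  for odd j.\<close>

definition bounded_overpartitions :: "nat \<Rightarrow> nat \<Rightarrow> (nat multiset \<times> nat set) set" where
  "bounded_overpartitions m n = {(M, S) \<in> overpartitions n. \<forall>k\<in>#M. k \<le> m}"

lemma bounded_overpartitions_0:
  "bounded_overpartitions 0 n = (if n = 0 then {({#}, {})} else {})"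
proof -
  have "(M, S) \<in> bounded_overpartitions 0 n \<longleftrightarrow> M = {#} \<and> S = {} \<and> n = 0" for M S
  proof
    assume *: "(M, S) \<in> bounded_overpartitions 0 n"
    have "M = {#}"
    proof (rule ccontr)
      assume "M \<noteq> {#}"
      then obtain k where "k \<in># M" by (rule multiset_nonemptyE)
      then show False using * by (auto simp: bounded_overpartitions_def overpartitions_def)
    qed
    then show "M = {#} \<and> S = {} \<and> n = 0"
      using * by (auto simp: bounded_overpartitions_def overpartitions_def)
  qed (auto simp: bounded_overpartitions_def overpartitions_def)
  then show ?thesis by auto
qed

lemma overpartitions_part_le:
  assumes "(M, S) \<in> overpartitions n" "k \<in># M" shows "k \<le> n"
proof -
  obtain M' where "M = add_mset k M'" using assms(2) by (metis insert_DiffM)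
  then show ?thesis using assms(1) by (auto simp: overpartitions_def)
qed

lemma bounded_overpartitions_eq:
  assumes "n \<le> m" shows "bounded_overpartitions m n = overpartitions n"
  using overpartitions_part_le assms by (fastforce simp: bounded_overpartitions_def)

text \<open>An overpartition with a part \<open>s\<close> arises by adding one copy of \<open>s\<close>; the set \<open>B\<close> consists of those
  in which this copy is the only one and is overlined.\<close>

lemma bounded_overpartitions_Suc:
  fixes m n defines "s \<equiv> Suc m"
  defines "A \<equiv> (\<lambda>(M, S). (add_mset s M, S)) ` bounded_overpartitions s (n - s)"
    and "B \<equiv> (\<lambda>(M, S). (add_mset s M, insert s S)) ` bounded_overpartitions m (n - s)"
  shows "bounded_overpartitions s n = bounded_overpartitions m n \<union> (if n < s then {} else A \<union> B)"
    and "bounded_overpartitions m n \<inter> (A \<union> B) = {}" and "A \<inter> B = {}"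
proof -
  have bound: "k \<le> s" if "k \<le> m" for k using that by (simp add: s_def)
  show "bounded_overpartitions s n = bounded_overpartitions m n \<union> (if n < s then {} else A \<union> B)"
  proof (intro equalityI subsetI)
    fix x assume x: "x \<in> bounded_overpartitions s n"
    obtain M S where MS: "x = (M, S)" by (cases x)
    show "x \<in> bounded_overpartitions m n \<union> (if n < s then {} else A \<union> B)"
    proof (cases "s \<in># M")
      case False
      then have "k \<le> m" if "k \<in># M" for k
        using that x unfolding MS bounded_overpartitions_def s_def by (auto simp: le_Suc_eq)
      then show ?thesis using x unfolding MS bounded_overpartitions_def by auto
    next
      case True
      then obtain M' where M': "M = add_mset s M'" by (metis insert_DiffM)
      have x': "\<forall>k\<in>#M'. 0 < k" "sum_mset M' = n - s" "s \<le> n" "S \<subseteq> insert s (set_mset M')" "\<forall>k\<in>#M'. k \<le> s"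
        using x unfolding MS M' bounded_overpartitions_def overpartitions_def by auto
      show ?thesis
      proof (cases "S \<subseteq> set_mset M'")
        case True
        then have "(M', S) \<in> bounded_overpartitions s (n - s)"
          using x' by (auto simp: bounded_overpartitions_def overpartitions_def)
        then have "x \<in> A"
          unfolding A_def MS M' by (intro image_eqI[of _ _ "(M', S)"]) auto
        then show ?thesis using x' by simp
      next
        case False
        then have s: "s \<in> S" "s \<notin># M'" using x' by auto
        then have "k \<le> m" if "k \<in># M'" for k
          using that x' unfolding s_def by (metis le_Suc_eq)
        then have "(M', S - {s}) \<in> bounded_overpartitions m (n - s)"
          using x' by (auto simp: bounded_overpartitions_def overpartitions_def)
        moreover have "insert s (S - {s}) = S" using s by auto
        ultimately have "x \<in> B"
          unfolding B_def MS M' by (intro image_eqI[of _ _ "(M', S - {s})"]) auto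
        then show ?thesis using x' by simp
      qed
    qed
  next
    fix x assume "x \<in> bounded_overpartitions m n \<union> (if n < s then {} else A \<union> B)"
    then show "x \<in> bounded_overpartitions s n"
      by (auto simp: A_def B_def bounded_overpartitions_def overpartitions_def s_def le_SucI split: if_splits)
  qed
  show "bounded_overpartitions m n \<inter> (A \<union> B) = {}"
    by (auto simp: A_def B_def bounded_overpartitions_def s_def)
  show "A \<inter> B = {}"
  proof (rule ccontr)
    assume "A \<inter> B \<noteq> {}"
    then obtain x where "x \<in> A" "x \<in> B" by blast
    from \<open>x \<in> A\<close> obtain M S where 1: "(M, S) \<in> bounded_overpartitions s (n - s)" "x = (add_mset s M, S)"
      unfolding A_def by (elim imageE, split prod.splits) simp
    from \<open>x \<in> B\<close> obtain M' S' where 2: "(M', S') \<in> bounded_overpartitions m (n - s)" "x = (add_mset s M', insert s S')"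
      unfolding B_def by (elim imageE, split prod.splits) simp
    from 1 2 have "M' = M" "S = insert s S'" by auto
    with 1 2 have "s \<in># M" "\<forall>k\<in>#M. k \<le> m"
      by (auto simp: bounded_overpartitions_def overpartitions_def)
    then show False by (auto simp: s_def)
  qed
qed

text \<open>Removing a copy of the largest admissible part can leave the bound on the parts
  unchanged while it lowers the sum, so an induction on \<open>n\<close> sits inside the one on
  \<open>m\<close>.\<close>

lemma finite_bounded_overpartitions: "finite (bounded_overpartitions m n)"
proof (induction m arbitrary: n)
  case 0
  then show ?case by (simp add: bounded_overpartitions_0)
next
  case (Suc m)
  show ?case
  proof (induction n rule: less_induct)
    case (less n)
    then show ?case using Suc.IH by (subst bounded_overpartitions_Suc(1)) auto
  qed
qed

lemma card_bounded_overpartitions_Suc: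
  "card (bounded_overpartitions (Suc m) n) = card (bounded_overpartitions m n) +
     (if n < Suc m then 0 else card (bounded_overpartitions (Suc m) (n - Suc m))
       + card (bounded_overpartitions m (n - Suc m)))"
proof -
  note fin = finite_bounded_overpartitions
  have "inj_on (\<lambda>(M, S). (add_mset (Suc m) M, S)) (bounded_overpartitions (Suc m) (n - Suc m))"
    by (auto simp: inj_on_def)
  moreover have "inj_on (\<lambda>(M, S). (add_mset (Suc m) M, insert (Suc m) S)) (bounded_overpartitions m (n - Suc m))"
  proof -
    \<comment> \<open>Inserting \<open>Suc m\<close> into the set of overlined parts is injective
      only because it was not there before.\<close>
    have "Suc m \<notin> S" if "(M, S) \<in> bounded_overpartitions m k" for M S k
    proof
      assume "Suc m \<in> S"
      then have "Suc m \<in># M" "\<forall>k\<in>#M. k \<le> m"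
        using that by (auto simp: bounded_overpartitions_def overpartitions_def)
      then show False by auto
    qed
    note notin = this
    show ?thesis
    proof (rule inj_onI)
      fix x y
      assume "x \<in> bounded_overpartitions m (n - Suc m)" "y \<in> bounded_overpartitions m (n - Suc m)"
        and "(case x of (M, S) \<Rightarrow> (add_mset (Suc m) M, insert (Suc m) S)) =
          (case y of (M, S) \<Rightarrow> (add_mset (Suc m) M, insert (Suc m) S))"
      then show "x = y"
        using notin[of "fst x" "snd x"] notin[of "fst y" "snd y"]
        by (auto simp: case_prod_unfold insert_ident prod_eq_iff)
    qed
  qed
  moreover note bounded_overpartitions_Suc(2,3)[of m n]
  ultimately show ?thesis
    unfolding bounded_overpartitions_Suc(1)[of m n]
    by (simp add: fin card_image card_Un_disjoint)
qed

definition bounded_gf :: "nat \<Rightarrow> int fps" where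
  "bounded_gf m = Abs_fps (\<lambda>n. int (card (bounded_overpartitions m n)))"

lemma bounded_gf_0: "bounded_gf 0 = 1"
  by (auto simp: fps_eq_iff bounded_gf_def bounded_overpartitions_0)

text \<open>For the partial products O_m of the generating function this is (1 - q^(m+1)) O_(m+1) =
  (1 + q^(m+1)) O_m, free of quotients and arranged for telescoping.\<close>

lemma bounded_gf_Suc:
  "fps_X ^ Suc m * (bounded_gf (Suc m) + bounded_gf m) = bounded_gf (Suc m) - bounded_gf m"
  by (rule fps_ext)
     (simp add: bounded_gf_def fps_X_power_mult_nth card_bounded_overpartitions_Suc[of m] del: power_Suc)

section \<open>A finite form of Gauss' identity\<close>

definition alternating_theta :: "nat \<Rightarrow> int fps" where
  "alternating_theta n = 1 + 2 * (\<Sum>j=1..n. (-1) ^ j * fps_X ^ (j\<^sup>2))"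

text \<open>The analogue for squares of Shanks' finite form of the pentagonal number theorem: the error term
  is divisible by \<open>q\<^bsup>n+1\<^esup>\<close>.\<close>

lemma alternating_theta_times_bounded_gf:
  "alternating_theta n * bounded_gf n =
     1 + (\<Sum>s=1..n. (-1) ^ s * fps_X ^ (s * Suc n) * (bounded_gf s + bounded_gf (s - 1)))"
proof (induction n)
  case 0
  then show ?case by (simp add: alternating_theta_def bounded_gf_0)
next
  case (Suc n)
  define X :: "int fps" where "X = fps_X"
  define N where "N = Suc n"
  define O' where "O' = bounded_gf"
  define w where "w s = O' s + O' (s - 1)" for s
  define q where "q = X ^ N"
  \<comment> \<open>The telescoping certificate: \<open>1 - q\<close> times a summand for
    \<open>N\<close>, minus \<open>1 + q\<close> times the corresponding summand for
    \<open>n\<close>, is a difference of consecutive values of \<open>g\<close>.\<close>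
  define g where "g s = 2 * (-1) ^ s * O' (s - 1) * q ^ s" for s
  have w: "X ^ s * w s = O' s - O' (s - 1)" if "1 \<le> s" for s
    using that bounded_gf_Suc[of "s - 1"] by (simp add: w_def X_def O'_def del: power_Suc)
  have H: "1 + (\<Sum>s=1..n. (-1) ^ s * q ^ s * w s) = alternating_theta n * O' n"
  proof -
    have "q ^ s = fps_X ^ (s * Suc n)" for s
      by (simp only: q_def X_def N_def power_mult[symmetric] mult.commute)
    then show ?thesis using Suc.IH by (simp only: w_def O'_def)
  qed
  have step: "(1 - q) * ((-1) ^ s * X ^ (s * Suc N) * w s) - (1 + q) * ((-1) ^ s * q ^ s * w s) = g (Suc s) - g s"
    if s: "1 \<le> s" for s
  proof -
    have "X ^ (s * Suc N) = q ^ s * X ^ s"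
      by (simp add: q_def power_mult[symmetric] power_add[symmetric] algebra_simps)
    then have "(1 - q) * ((-1) ^ s * X ^ (s * Suc N) * w s) - (1 + q) * ((-1) ^ s * q ^ s * w s)
       = (-1) ^ s * q ^ s * ((1 - q) * (X ^ s * w s) - (1 + q) * w s)"
      by (simp add: algebra_simps)
    also have "\<dots> = (-1) ^ s * q ^ s * ((1 - q) * (O' s - O' (s - 1)) - (1 + q) * (O' s + O' (s - 1)))"
      by (simp add: w[OF s]) (simp add: w_def)
    also have "\<dots> = g (Suc s) - g s" by (simp add: g_def algebra_simps)
    finally show ?thesis .
  qed
  have qw: "q * w N = O' N - O' n" using w[of N] by (simp add: q_def N_def)
  have N1: "1 \<le> N" by (simp add: N_def)
  \<comment> \<open>The two factors are those in \<open>(1 - q) * O' N = (1 + q) * O' n\<close>, so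
    the induction hypothesis about \<open>O' n\<close> can be compared with the claim about
    \<open>O' N\<close>.\<close>
  have "(1 - q) * (1 + (\<Sum>s=1..N. (-1) ^ s * X ^ (s * Suc N) * w s))
      - (1 + q) * (1 + (\<Sum>s=1..n. (-1) ^ s * q ^ s * w s))
     = - 2 * q + (\<Sum>s=1..n. (1 - q) * ((-1) ^ s * X ^ (s * Suc N) * w s) - (1 + q) * ((-1) ^ s * q ^ s * w s))
       + (1 - q) * ((-1) ^ N * X ^ (N * Suc N) * w N)"
  proof -
    have "(1 - q) * (1 + (A + T)) - (1 + q) * (1 + B) = - 2 * q + ((1 - q) * A - (1 + q) * B) + (1 - q) * T"
      for A B T by (simp add: algebra_simps)
    moreover have "(\<Sum>s=1..N. f s) = (\<Sum>s=1..n. f s) + f N" for f :: "nat \<Rightarrow> int fps"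
      by (simp add: N_def)
    ultimately show ?thesis by (simp only: sum_subtractf sum_distrib_left[symmetric])
  qed
  also have "(\<Sum>s=1..n. (1 - q) * ((-1) ^ s * X ^ (s * Suc N) * w s) - (1 + q) * ((-1) ^ s * q ^ s * w s))
      = (\<Sum>s=1..n. g (Suc s) - g s)" by (intro sum.cong refl step) simp
  also have "\<dots> = g N - g 1" unfolding N_def by (induction n) (auto simp: sum.atLeast_Suc_atMost)
  also have "X ^ (N * Suc N) = q ^ N * q" by (simp add: q_def power_mult[symmetric] power_add[symmetric] add.commute)
  also have "g 1 = - 2 * q" by (simp add: g_def O'_def bounded_gf_0)
  also have "- 2 * q + (g N - - 2 * q) + (1 - q) * ((-1) ^ N * (q ^ N * q) * w N)
      = (-1) ^ N * q ^ N * (2 * O' n + (1 - q) * (q * w N))"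
    by (simp add: g_def N_def algebra_simps)
  also have "2 * O' n + (1 - q) * (q * w N) = 2 * (1 - q) * O' N"
  proof -
    have "2 * O' n = (1 - q) * w N" using qw by (simp add: w_def N_def algebra_simps)
    then show ?thesis by (simp add: qw) (simp add: w_def N_def algebra_simps)
  qed
  finally have key: "(1 - q) * (1 + (\<Sum>s=1..N. (-1) ^ s * X ^ (s * Suc N) * w s))
     = (1 + q) * (alternating_theta n * O' n) + (-1) ^ N * q ^ N * (2 * (1 - q) * O' N)"
    unfolding H by (simp add: algebra_simps)
  have "(1 - q) * O' N = (1 + q) * O' n" using qw by (simp add: w_def N_def algebra_simps)
  then have "(1 + q) * (alternating_theta n * O' n) = (1 - q) * (alternating_theta n * O' N)"
    by (simp only: mult.left_commute[of _ "alternating_theta n"])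
  then have prod: "(1 - q) * (1 + (\<Sum>s=1..N. (-1) ^ s * X ^ (s * Suc N) * w s))
     = (1 - q) * ((alternating_theta n + 2 * ((-1) ^ N * q ^ N)) * O' N)"
    unfolding key by (simp add: algebra_simps)
  have alt: "alternating_theta N = alternating_theta n + 2 * ((-1) ^ N * q ^ N)"
  proof -
    have "q ^ N = fps_X ^ (N\<^sup>2)" by (simp only: q_def X_def power_mult[symmetric] power2_eq_square)
    moreover have "(\<Sum>j=1..N. f j) = (\<Sum>j=1..n. f j) + f N" for f :: "nat \<Rightarrow> int fps"
      by (simp add: N_def)
    ultimately show ?thesis by (simp only: alternating_theta_def distrib_left add.assoc)
  qed
  have ne: "1 - q \<noteq> 0"
  proof
    assume "1 - q = 0"
    then have "fps_nth (1 - q) 0 = 0" by simp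
    then show False by (simp add: q_def X_def N_def)
  qed
  have "1 + (\<Sum>s=1..N. (-1) ^ s * X ^ (s * Suc N) * w s) = alternating_theta N * O' N"
    unfolding alt by (rule mult_left_cancel[OF ne, THEN iffD1, OF prod])
  from this[symmetric] show ?case by (simp only: N_def O'_def X_def w_def)
qed

definition theta :: "int fps" where
  "theta = Abs_fps (\<lambda>k. int (card {x :: int. x\<^sup>2 = int k}))"

text \<open>Since j and j^2 have the same parity, the signs amount to replacing q by -q. The factor
  2 in \<open>alternating_theta\<close> stands for the two roots of a positive square, and
  \<open>k \<le> n\<close> makes the sum long enough to contain the root of
  \<open>k\<close>.\<close>

lemma alternating_theta_nth:
  assumes "k \<le> n"
  shows "fps_nth (alternating_theta n) k = (-1) ^ k * fps_nth theta k"
proof -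
  have sum_nth: "fps_nth (alternating_theta n) k = (if k = 0 then 1 else 0) + 2 * (\<Sum>j=1..n. if k = j\<^sup>2 then (-1) ^ j else 0)"
  proof -
    have "fps_nth ((-1) ^ j * fps_X ^ m) k = (if k = m then (-1) ^ j else (0 :: int))" for j m
      by (cases "even j") (auto simp: fps_X_power_nth)
    then show ?thesis by (simp add: alternating_theta_def fps_sum_nth numeral_fps_const)
  qed
  show ?thesis
  proof (cases "\<exists>i. k = i\<^sup>2")
    case False
    have "k = (nat \<bar>x\<bar>)\<^sup>2" if "x\<^sup>2 = int k" for x :: int
      using that by (simp flip: of_nat_eq_iff[where 'a = int])
    then have "{x :: int. x\<^sup>2 = int k} = {}" using False by blast
    moreover have "k \<noteq> 0" using False by (metis zero_power2)
    ultimately show ?thesis using False unfolding sum_nth by (auto simp: theta_def intro!: sum.neutral)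
  next
    case True
    then obtain i where i: "k = i\<^sup>2" by blast
    have "{x :: int. x\<^sup>2 = int k} = {int i, - int i}"
      by (auto simp: i power2_eq_iff)
    then have card: "fps_nth theta k = (if i = 0 then 1 else 2)" by (simp add: theta_def)
    show ?thesis
    proof (cases "i = 0")
      case True
      then have "(\<Sum>j=1..n. if k = j\<^sup>2 then (-1) ^ j else (0 :: int)) = 0"
        by (intro sum.neutral) (auto simp: i)
      then show ?thesis unfolding sum_nth card using True by (simp add: i)
    next
      case False
      have "i \<le> n" using assms i by (metis le_square le_trans power2_eq_square)
      have "(\<Sum>j=1..n. if k = j\<^sup>2 then (-1) ^ j else (0 :: int)) = (\<Sum>j=1..n. if j = i then (-1) ^ i else 0)"
        by (intro sum.cong) (auto simp: i)
      also have "\<dots> = (-1) ^ i" using \<open>i \<le> n\<close> False by simp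
      also have "(-1) ^ i = (-1 :: int) ^ k" by (simp add: i minus_one_power_iff)
      finally show ?thesis using False unfolding sum_nth card by (simp add: i)
    qed
  qed
qed

text \<open>The signs are chosen such that the inverse is \<open>\<theta>(q)\<close> rather than \<open>\<theta>(-q)\<close>.\<close>

definition overpartition_gf :: "int fps" where
  "overpartition_gf = Abs_fps (\<lambda>n. (-1) ^ n * int (overpartition_count n))"

text \<open>The coefficient at \<open>k\<close> is computed from the finite identity with bound
  \<open>k\<close>: there the parts are not really restricted, and every error term starts at degree
  \<open>k + 1\<close> or later.\<close>

theorem overpartition_gf_times_theta: "overpartition_gf * theta = 1"
proof (rule fps_ext)
  fix k
  have O_nth: "(-1) ^ k * (fps_nth overpartition_gf i * fps_nth theta (k - i))
       = fps_nth (bounded_gf k) i * fps_nth (alternating_theta k) (k - i)" if "i \<le> k" for i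
  proof -
    have "(-1 :: int) ^ k * (-1) ^ i = (-1) ^ (k - i)"
      using that by (simp add: minus_one_power_iff)
    then show ?thesis
      using that by (simp add: overpartition_gf_def bounded_gf_def overpartition_count_def
          bounded_overpartitions_eq alternating_theta_nth mult.assoc[symmetric])
  qed
  have "(-1) ^ k * fps_nth (overpartition_gf * theta) k = fps_nth (bounded_gf k * alternating_theta k) k"
    unfolding fps_mult_nth sum_distrib_left by (intro sum.cong) (auto simp: O_nth)
  also have "\<dots> = fps_nth 1 k"
  proof -
    have "fps_nth ((-1) ^ s * fps_X ^ (s * Suc k) * f) k = (0 :: int)" if "1 \<le> s" for s f
    proof -
      have "k < s * Suc k" using that by (metis lessI less_le_trans mult_le_mono1 nat_mult_1)
      then show ?thesis by (simp add: mult.assoc mult.left_commute[of "(-1) ^ s"] fps_X_power_mult_nth del: mult_Suc_right)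
    qed
    then show ?thesis
      using alternating_theta_times_bounded_gf[of k]
      by (simp add: mult.commute[of "bounded_gf k"] fps_sum_nth del: mult_Suc_right)
  qed
  finally show "fps_nth (overpartition_gf * theta) k = fps_nth 1 k"
    by (cases "k = 0") (auto simp: minus_one_power_iff split: if_splits)
qed

section \<open>Overpartitions of multiples of 3 and sums of five squares\<close>

definition dilate :: "int fps \<Rightarrow> int fps" where
  "dilate F = F oo fps_X ^ 3"

lemma dilate_nth: "fps_nth (dilate F) n = (if 3 dvd n then fps_nth F (n div 3) else 0)"
proof -
  have nth: "fps_nth (dilate F) n = (\<Sum>i=0..n. if n = 3 * i then fps_nth F i else 0)"
    unfolding dilate_def fps_compose_nth
    by (intro sum.cong refl) (simp add: power_mult[symmetric] fps_X_power_nth)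
  show ?thesis
  proof (cases "3 dvd n")
    case True
    then obtain m where m: "n = 3 * m" ..
    have "(\<Sum>i=0..n. if n = 3 * i then fps_nth F i else 0) = (\<Sum>i=0..n. if i = m then fps_nth F i else 0)"
      by (intro sum.cong refl) (auto simp: m)
    then show ?thesis unfolding nth by (simp add: m)
  next
    case False
    then show ?thesis unfolding nth by (auto intro!: sum.neutral)
  qed
qed

lemma dilate_X: "dilate fps_X = fps_X ^ 3"
  by (simp add: dilate_def)

lemma dilate_const: "dilate (fps_const c) = fps_const c"
  by (simp add: dilate_def)

lemma dilate_add: "dilate (F + G) = dilate F + dilate G"
  by (simp add: dilate_def fps_compose_add_distrib)

lemma dilate_mult: "dilate (F * G) = dilate F * dilate G"
  unfolding dilate_def by (rule fps_compose_mult_distrib) simp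

lemma dilate_power: "dilate (F ^ k) = dilate F ^ k"
  by (induction k) (simp_all add: dilate_mult, simp add: dilate_def)

lemma dilate_inj: "dilate F = dilate G \<Longrightarrow> F = G"
proof (rule fps_ext)
  fix n assume "dilate F = dilate G"
  then have "fps_nth (dilate F) (3 * n) = fps_nth (dilate G) (3 * n)" by simp
  then show "fps_nth F n = fps_nth G n" by (simp add: dilate_nth)
qed

definition trisect :: "int fps \<Rightarrow> int fps" where
  "trisect F = Abs_fps (\<lambda>n. fps_nth F (3 * n))"

text \<open>Only indices divisible by 3 contribute to the convolution, so trisection is linear over
  series in q^3. A denominator in q^3 can thus be cleared before trisecting.\<close>

lemma trisect_dilate_mult: "trisect (dilate F * G) = F * trisect G"
proof (rule fps_ext)
  fix n
  have "fps_nth (trisect (dilate F * G)) n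
      = (\<Sum>i\<in>{0..3 * n}. if 3 dvd i then fps_nth F (i div 3) * fps_nth G (3 * n - i) else 0)"
    by (simp add: trisect_def fps_mult_nth dilate_nth if_distrib[of "\<lambda>x. x * _"] cong: if_cong)
  also have "\<dots> = (\<Sum>i\<in>(*) 3 ` {0..n}. fps_nth F (i div 3) * fps_nth G (3 * n - i))"
    by (rule sum.mono_neutral_cong_right) (auto simp: dvd_def)
  also have "\<dots> = (\<Sum>j=0..n. fps_nth F j * fps_nth G (3 * (n - j)))"
    by (subst sum.reindex) (auto simp: inj_on_def right_diff_distrib')
  also have "\<dots> = fps_nth (F * trisect G) n"
    by (simp add: trisect_def fps_mult_nth)
  finally show "fps_nth (trisect (dilate F * G)) n = fps_nth (F * trisect G) n" .
qed

lemma trisect_dilate: "trisect (dilate F) = F"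
  by (rule fps_ext) (simp add: trisect_def dilate_nth)

lemma trisect_add: "trisect (F + G) = trisect F + trisect G"
  by (rule fps_ext) (simp add: trisect_def)

lemma trisect_diff: "trisect (F - G) = trisect F - trisect G"
  by (rule fps_ext) (simp add: trisect_def)

lemma trisect_X_power_dilate:
  assumes "\<not> 3 dvd r" shows "trisect (fps_X ^ r * dilate F) = 0"
proof (rule fps_ext)
  fix n
  have "\<not> 3 dvd 3 * n - r" if "r \<le> 3 * n"
    using that assms by presburger
  then show "fps_nth (trisect (fps_X ^ r * dilate F)) n = fps_nth 0 n"
    by (auto simp: trisect_def fps_X_power_mult_nth dilate_nth)
qed

text \<open>Finite fibres keep \<open>card\<close> from returning its default 0 on infinite sets;
  nonnegative weights make the convolution over a product of sets a finite sum.\<close>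

definition graded :: "'a set \<Rightarrow> ('a \<Rightarrow> int) \<Rightarrow> bool" where
  "graded A f \<longleftrightarrow> (\<forall>x\<in>A. 0 \<le> f x) \<and> (\<forall>k. finite {x \<in> A. f x = int k})"

definition counting_fps :: "'a set \<Rightarrow> ('a \<Rightarrow> int) \<Rightarrow> int fps" where
  "counting_fps A f = Abs_fps (\<lambda>k. int (card {x \<in> A. f x = int k}))"

lemma fiber_Times:
  assumes "graded A f" "graded B g"
  shows "{z \<in> A \<times> B. (case z of (x, y) \<Rightarrow> f x + g y) = int k}
    = (\<Union>i\<in>{0..k}. {x \<in> A. f x = int i} \<times> {y \<in> B. g y = int (k - i)})" (is "?L = ?R")
proof (intro equalityI subsetI)
  fix z assume z: "z \<in> ?L"
  obtain x y where xy: "z = (x, y)" by (cases z)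
  have "0 \<le> f x" "0 \<le> g y" "f x + g y = int k" using z assms by (auto simp: xy graded_def)
  then have "nat (f x) \<in> {0..k}" "f x = int (nat (f x))" "g y = int (k - nat (f x))" by auto
  moreover have "x \<in> A" "y \<in> B" using z by (auto simp: xy)
  ultimately have "z \<in> {x \<in> A. f x = int (nat (f x))} \<times> {y \<in> B. g y = int (k - nat (f x))}"
    by (simp add: xy)
  then show "z \<in> ?R" using \<open>nat (f x) \<in> {0..k}\<close> \<open>f x = int (nat (f x))\<close>
    by (intro UN_I[of "nat (f x)"]) (auto simp: xy)
qed auto

lemma graded_Times:
  assumes "graded A f" "graded B g"
  shows "graded (A \<times> B) (\<lambda>(x, y). f x + g y)"
proof -
  have "finite ({x \<in> A. f x = int i} \<times> {y \<in> B. g y = int j})" for i j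
    using assms by (intro finite_cartesian_product) (auto simp: graded_def)
  then have "finite (\<Union>i\<in>{0..k}. {x \<in> A. f x = int i} \<times> {y \<in> B. g y = int (k - i)})" for k by blast
  then show ?thesis
    using assms unfolding graded_def[of "A \<times> B"] fiber_Times[OF assms] by (auto simp: graded_def)
qed

lemma counting_fps_Times:
  assumes "graded A f" "graded B g"
  shows "counting_fps (A \<times> B) (\<lambda>(x, y). f x + g y) = counting_fps A f * counting_fps B g"
proof (rule fps_ext)
  fix k
  have "card {z \<in> A \<times> B. (case z of (x, y) \<Rightarrow> f x + g y) = int k}
     = (\<Sum>i\<in>{0..k}. card ({x \<in> A. f x = int i} \<times> {y \<in> B. g y = int (k - i)}))"
    unfolding fiber_Times[OF assms]
  proof (intro card_UN_disjoint ballI impI)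
    show "finite ({x \<in> A. f x = int i} \<times> {y \<in> B. g y = int (k - i)})" for i
      using assms by (intro finite_cartesian_product) (auto simp: graded_def simp del: of_nat_diff)
  qed auto
  then show "fps_nth (counting_fps (A \<times> B) (\<lambda>(x, y). f x + g y)) k = fps_nth (counting_fps A f * counting_fps B g) k"
    by (simp add: counting_fps_def fps_mult_nth card_cartesian_product del: of_nat_diff)
qed

lemma counting_fps_bij_betw:
  assumes "bij_betw h A B" "\<And>x. x \<in> A \<Longrightarrow> f (h x) = g x"
  shows "counting_fps A g = counting_fps B f"
proof -
  have "bij_betw h {x \<in> A. g x = int k} {y \<in> B. f y = int k}" for k
    using assms by (auto simp: bij_betw_def inj_on_def)
  then have "card {x \<in> A. g x = int k} = card {y \<in> B. f y = int k}" for k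
    by (rule bij_betw_same_card)
  then show ?thesis by (simp add: counting_fps_def)
qed

lemma graded_subset:
  assumes "graded B f" "A \<subseteq> B" shows "graded A f"
proof -
  have "finite {x \<in> A. f x = int k}" for k
  proof (rule finite_subset)
    show "{x \<in> A. f x = int k} \<subseteq> {x \<in> B. f x = int k}" using assms(2) by blast
    show "finite {x \<in> B. f x = int k}" using assms(1) unfolding graded_def by blast
  qed
  moreover have "\<forall>x\<in>A. 0 \<le> f x" using assms unfolding graded_def by blast
  ultimately show ?thesis unfolding graded_def by blast
qed

lemma counting_fps_UN:
  assumes "finite I" "graded (\<Union>i\<in>I. A i) f" "\<And>i j. i \<in> I \<Longrightarrow> j \<in> I \<Longrightarrow> i \<noteq> j \<Longrightarrow> A i \<inter> A j = {}"
  shows "counting_fps (\<Union>i\<in>I. A i) f = (\<Sum>i\<in>I. counting_fps (A i) f)"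
proof (rule fps_ext)
  fix k
  have "{x \<in> (\<Union>i\<in>I. A i). f x = int k} = (\<Union>i\<in>I. {x \<in> A i. f x = int k})" by auto
  moreover have "finite {x \<in> A i. f x = int k}" if "i \<in> I" for i
    using graded_subset[OF assms(2), of "A i"] that by (auto simp: graded_def)
  moreover have "{x \<in> A i. f x = int k} \<inter> {x \<in> A j. f x = int k} = {}" if "i \<in> I" "j \<in> I" "i \<noteq> j" for i j
    using assms(3)[OF that] by auto
  ultimately have "card {x \<in> (\<Union>i\<in>I. A i). f x = int k} = (\<Sum>i\<in>I. card {x \<in> A i. f x = int k})"
    using assms(1) by (simp add: card_UN_disjoint)
  then show "fps_nth (counting_fps (\<Union>i\<in>I. A i) f) k = fps_nth (\<Sum>i\<in>I. counting_fps (A i) f) k"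
    by (simp add: counting_fps_def fps_sum_nth)
qed

lemma graded_square: "graded (A :: int set) (\<lambda>x. x\<^sup>2)"
proof -
  have "finite {x \<in> A. x\<^sup>2 = int k}" for k
  proof (rule finite_subset)
    show "{x \<in> A. x\<^sup>2 = int k} \<subseteq> {- int k..int k}"
    proof
      fix x assume "x \<in> {x \<in> A. x\<^sup>2 = int k}"
      then have "\<bar>x\<bar> * \<bar>x\<bar> = int k" by (simp add: power2_eq_square)
      moreover have "\<bar>x\<bar> * 1 \<le> \<bar>x\<bar> * \<bar>x\<bar>" 
        using mult_left_mono[of 1 "\<bar>x\<bar>" "\<bar>x\<bar>"] by (cases "x = 0") auto
      ultimately have "\<bar>x\<bar> \<le> int k" by simp
      then show "x \<in> {- int k..int k}" by auto
    qed
  qed simp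
  then show ?thesis by (auto simp: graded_def)
qed

lemma theta_counting: "theta = counting_fps UNIV (\<lambda>x. x\<^sup>2)"
  by (simp add: theta_def counting_fps_def)

lemma counting_fps_times_3: "counting_fps A (\<lambda>x. 3 * f x) = dilate (counting_fps A f)"
proof (rule fps_ext)
  fix k
  have "{x \<in> A. 3 * f x = int k} = (if 3 dvd k then {x \<in> A. f x = int (k div 3)} else {})"
    by auto presburger+
  then show "fps_nth (counting_fps A (\<lambda>x. 3 * f x)) k = fps_nth (dilate (counting_fps A f)) k"
    by (simp add: counting_fps_def dilate_nth)
qed

section \<open>The 3-dissection of theta\<close>

definition residue_theta :: "int \<Rightarrow> int fps" where
  "residue_theta r = counting_fps {x. x mod 3 = r} (\<lambda>x. x\<^sup>2)"

lemma residue_theta_0: "residue_theta 0 = dilate (dilate theta)"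
proof -
  have "bij_betw (\<lambda>x. 3 * x) UNIV {x :: int. x mod 3 = 0}"
    by (rule bij_betw_byWitness[where f' = "\<lambda>x. x div 3"]) auto
  then have "counting_fps UNIV (\<lambda>x :: int. 3 * (3 * x\<^sup>2)) = residue_theta 0"
    unfolding residue_theta_def by (rule counting_fps_bij_betw) (simp add: power2_eq_square)
  then show ?thesis unfolding theta_counting counting_fps_times_3[symmetric] by simp
qed

lemma residue_theta_2: "residue_theta 2 = residue_theta 1"
proof -
  have "bij_betw uminus {x :: int. x mod 3 = 2} {x. x mod 3 = 1}"
    by (rule bij_betw_byWitness[where f' = uminus]) (auto, presburger+)
  then show ?thesis
    unfolding residue_theta_def by (rule counting_fps_bij_betw) simp
qed

text \<open>This is the sum of q^((x^2 - 1)/3) over the integers x not divisible by 3.\<close>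

definition offset_theta :: "int fps" where
  "offset_theta = Abs_fps (\<lambda>n. fps_nth theta (3 * n + 1))"

text \<open>Squares are 0 or 1 modulo 3, so the exponents that are 1 modulo 3 come exactly from the
  x not divisible by 3. Negation exchanges the residues 1 and 2, whence the factor 2.\<close>

lemma residue_theta_1: "2 * residue_theta 1 = fps_X * dilate offset_theta"
  and theta_dissection: "theta = dilate (dilate theta) + fps_X * dilate offset_theta"
proof -
  have split: "theta = residue_theta 0 + residue_theta 1 + residue_theta 2"
  proof -
    have "(\<Union>r\<in>{0, 1, 2}. {x :: int. x mod 3 = r}) = UNIV"
      by auto
    then have "theta = (\<Sum>r\<in>{0, 1, 2}. counting_fps {x :: int. x mod 3 = r} (\<lambda>x. x\<^sup>2))"
      unfolding theta_counting by (subst counting_fps_UN[symmetric]) (auto simp: graded_square)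
    then show ?thesis by (simp add: residue_theta_def add.assoc)
  qed
  have sq: "x\<^sup>2 mod 3 = (if x mod 3 = 0 then 0 else 1)" for x :: int
  proof -
    have "x mod 3 = 0 \<or> x mod 3 = 1 \<or> x mod 3 = 2" by presburger
    then show ?thesis using power_mod[of x 3 2] by auto
  qed
  have r0: "fps_nth (residue_theta 0) n = 0" if "n mod 3 \<noteq> 0" for n
    using that by (auto simp: residue_theta_0 dilate_nth)
  have r1: "fps_nth (residue_theta 1) n = 0" if "n mod 3 \<noteq> 1" for n
  proof -
    have "x\<^sup>2 \<noteq> int n" if "x mod 3 = 1" for x :: int
    proof
      assume "x\<^sup>2 = int n"
      then have "int n mod 3 = 1" using sq[of x] that by simp
      then show False using \<open>n mod 3 \<noteq> 1\<close> by presburger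
    qed
    then have "card {x :: int. x mod 3 = 1 \<and> x\<^sup>2 = int n} = card ({} :: int set)"
      by (intro arg_cong[of _ _ card]) blast
    then show ?thesis by (simp add: residue_theta_def counting_fps_def)
  qed
  show *: "2 * residue_theta 1 = fps_X * dilate offset_theta"
  proof (rule fps_ext)
    fix n
    show "fps_nth (2 * residue_theta 1) n = fps_nth (fps_X * dilate offset_theta) n"
    proof (cases "n mod 3 = 1")
      case True
      then obtain m where m: "n = 3 * m + 1" by (metis mult_div_mod_eq)
      then have "fps_nth (residue_theta 0) (Suc (3 * m)) = 0" by (intro r0) presburger
      then show ?thesis
        using arg_cong[OF split, of "\<lambda>F. fps_nth F n"]
        by (simp add: m residue_theta_2 offset_theta_def dilate_nth numeral_fps_const)
    next
      case False
      moreover have "\<not> 3 dvd n - 1" if "n \<noteq> 0" using that False by presburger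
      ultimately show ?thesis by (auto simp: r1 dilate_nth numeral_fps_const)
    qed
  qed
  show "theta = dilate (dilate theta) + fps_X * dilate offset_theta"
    unfolding *[symmetric] residue_theta_0[symmetric]
    by (subst split) (simp add: residue_theta_2)
qed

section \<open>Sums of four squares and the tetracode\<close>

definition norm4 :: "int \<times> int \<times> int \<times> int \<Rightarrow> int" where
  "norm4 = (\<lambda>(a, b). a\<^sup>2 + (\<lambda>(b, c). b\<^sup>2 + (\<lambda>(c, d). c\<^sup>2 + d\<^sup>2) c) b)"

lemma graded_norm4: "graded (A \<times> B \<times> C \<times> D) norm4"
  unfolding norm4_def by (intro graded_Times graded_square)

text \<open>\<open>norm4\<close> is written as nested sums over pairs so that
  \<open>counting_fps_Times\<close> applies verbatim at each level.\<close>

lemma counting_fps_norm4: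
  "counting_fps (A \<times> B \<times> C \<times> D) norm4 = counting_fps A (\<lambda>x. x\<^sup>2) * (counting_fps B (\<lambda>x. x\<^sup>2) *
     (counting_fps C (\<lambda>x. x\<^sup>2) * counting_fps D (\<lambda>x. x\<^sup>2)))"
  unfolding norm4_def by (simp add: counting_fps_Times graded_Times graded_square)

text \<open>The vectors whose reduction modulo 3 lies in the self-dual ternary code of length 4, in which
  every nonzero word has exactly three nonzero entries.\<close>

definition tetracode_lattice :: "(int \<times> int \<times> int \<times> int) set" where
  "tetracode_lattice = {(a, b, c, d). 3 dvd b + c + d \<and> 3 dvd a + c - d}"

text \<open>The lattice is the union of nine cosets of the vectors divisible by 3, one for each code
  word. The zero word gives the fourth power; each of the other eight has one zero entry and three
  nonzero ones, and the residues 1 and 2 contribute equally.\<close>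

lemma tetracode_lattice_theta:
  "counting_fps tetracode_lattice norm4 = residue_theta 0 ^ 4 + 8 * residue_theta 0 * residue_theta 1 ^ 3"
proof -
  define C :: "int \<Rightarrow> int set" where "C r = {x. x mod 3 = r}" for r
  \<comment> \<open>The last two entries \<open>s\<close>, \<open>t\<close> determine the code word;
    \<open>A (s, t)\<close> is the coset above it.\<close>
  define A where "A = (\<lambda>(s, t). C ((t - s) mod 3) \<times> C ((- s - t) mod 3) \<times> C s \<times> C t)"
  define I :: "(int \<times> int) set" where "I = {0, 1, 2} \<times> {0, 1, 2}"
  have mem: "(a, b, c, d) \<in> A (s, t) \<longleftrightarrow>
      a mod 3 = (t - s) mod 3 \<and> b mod 3 = (- s - t) mod 3 \<and> c mod 3 = s \<and> d mod 3 = t" for a b c d s t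
    by (simp add: A_def C_def)
  have L: "tetracode_lattice = (\<Union>i\<in>I. A i)"
  proof (intro equalityI subsetI)
    fix x assume x: "x \<in> tetracode_lattice"
    obtain a b c d where abcd: "x = (a, b, c, d)" by (cases x)
    have "a mod 3 = (d mod 3 - c mod 3) mod 3" "b mod 3 = (- (c mod 3) - d mod 3) mod 3"
      using x unfolding abcd tetracode_lattice_def by (simp; presburger)+
    then have "x \<in> A (c mod 3, d mod 3)" unfolding abcd mem by blast
    moreover have "c mod 3 \<in> {0, 1, 2}" for c :: int by (simp; presburger)
    then have "(c mod 3, d mod 3) \<in> I" unfolding I_def by (intro SigmaI)
    ultimately show "x \<in> (\<Union>i\<in>I. A i)" by (rule UN_I[rotated])
  next
    fix x assume "x \<in> (\<Union>i\<in>I. A i)"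
    then obtain i where "x \<in> A i" by (rule UN_E)
    obtain s t where i: "i = (s, t)" by (cases i)
    obtain a b c d where abcd: "x = (a, b, c, d)" by (cases x)
    have a: "a mod 3 = (t - s) mod 3" and b: "b mod 3 = (- s - t) mod 3"
      and cd: "c mod 3 = s" "d mod 3 = t"
      using \<open>x \<in> A i\<close> unfolding abcd i mem by blast+
    have "a mod 3 = (d mod 3 - c mod 3) mod 3" "b mod 3 = (- (c mod 3) - d mod 3) mod 3"
      unfolding cd by (rule a, rule b)
    then have "3 dvd a - (d mod 3 - c mod 3)" "3 dvd b - (- (c mod 3) - d mod 3)"
      by (simp_all only: mod_eq_dvd_iff)
    moreover have "3 dvd c - c mod 3" "3 dvd d - d mod 3" by (rule dvd_minus_mod)+
    ultimately have "3 dvd (b - (- (c mod 3) - d mod 3)) + (c - c mod 3) + (d - d mod 3)"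
      "3 dvd (a - (d mod 3 - c mod 3)) + (c - c mod 3) - (d - d mod 3)"
      by (blast intro: dvd_add dvd_diff)+
    then have "3 dvd b + c + d" "3 dvd a + c - d" by (simp_all add: algebra_simps)
    then show "x \<in> tetracode_lattice" unfolding tetracode_lattice_def abcd by simp
  qed
  have "graded (UNIV \<times> UNIV \<times> UNIV \<times> UNIV) norm4" by (rule graded_norm4)
  then have "graded (\<Union>i\<in>I. A i) norm4" by (rule graded_subset) simp
  moreover have "A i \<inter> A j = {}" if "i \<noteq> j" for i j
  proof -
    have "(fst (snd (snd x)) mod 3, snd (snd (snd x)) mod 3) = i" if "x \<in> A i" for x i
      using that by (cases i; cases x) (simp add: mem)
    with that show ?thesis by blast
  qed
  ultimately have "counting_fps tetracode_lattice norm4 = (\<Sum>i\<in>I. counting_fps (A i) norm4)"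
    unfolding L by (intro counting_fps_UN) (simp_all add: I_def)
  also have "\<dots> = (\<Sum>s\<in>{0, 1, 2}. \<Sum>t\<in>{0, 1, 2}. residue_theta ((t - s) mod 3) *
      (residue_theta ((- s - t) mod 3) * (residue_theta s * residue_theta t)))"
  proof -
    have "counting_fps (A (s, t)) norm4 = residue_theta ((t - s) mod 3) *
      (residue_theta ((- s - t) mod 3) * (residue_theta s * residue_theta t))" for s t
      by (simp only: A_def prod.case C_def residue_theta_def counting_fps_norm4)
    then show ?thesis unfolding I_def sum.cartesian_product by (intro sum.cong) auto
  qed
  also have "\<dots> = residue_theta 0 ^ 4 + 8 * residue_theta 0 * residue_theta 1 ^ 3"
    by (simp add: residue_theta_2 power4_eq_xxxx power3_eq_cube algebra_simps)
  finally show ?thesis .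
qed

text \<open>\<open>?h\<close> is a weighing matrix: its columns are pairwise orthogonal of norm 3,
  so it multiplies norms by 3, and a third of its transpose, \<open>?g\<close>, is its
  inverse.\<close>

lemma theta_power4_dilate: "counting_fps tetracode_lattice norm4 = dilate (theta ^ 4)"
proof -
  let ?h = "\<lambda>(a, b, c, d). (b + c + d, a - c + d, a + b - d, a - b + c) :: int \<times> int \<times> int \<times> int"
  let ?g = "\<lambda>(a, b, c, d). ((b + c + d) div 3, (a + c - d) div 3, (a - b + d) div 3, (a + b - c) div 3) :: int \<times> int \<times> int \<times> int"
  have "bij_betw ?h UNIV tetracode_lattice"
  proof (rule bij_betw_byWitness[where f' = ?g])
    show "\<forall>x\<in>UNIV. ?g (?h x) = x" by auto
    show "\<forall>x\<in>tetracode_lattice. ?h (?g x) = x"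
    proof
      fix x assume x: "x \<in> tetracode_lattice"
      obtain a b c d where abcd: "x = (a, b, c, d)" by (cases x)
      obtain u v where uv: "b + c + d = 3 * u" "a + c - d = 3 * v"
        using x unfolding abcd tetracode_lattice_def by (auto elim!: dvdE)
      \<comment> \<open>The lattice is defined by the divisibility of the first two entries of the
        transposed product; that of the other two follows.\<close>
      then have eqs: "a - b + d = 3 * (v - u + d)" "a + b - c = 3 * (u + v - c)" by auto
      have "(b + c + d) div 3 = u" "(a + c - d) div 3 = v" "(a - b + d) div 3 = v - u + d"
        "(a + b - c) div 3 = u + v - c" unfolding uv eqs by simp_all
      then show "?h (?g x) = x" unfolding abcd prod.case using uv by auto
    qed
    show "?h ` UNIV \<subseteq> tetracode_lattice" unfolding tetracode_lattice_def by (auto; presburger)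
  qed auto
  then have "counting_fps UNIV (\<lambda>x. 3 * norm4 x) = counting_fps tetracode_lattice norm4"
    by (rule counting_fps_bij_betw) (auto simp: norm4_def power2_eq_square algebra_simps)
  moreover have "counting_fps UNIV norm4 = theta ^ 4"
    using counting_fps_norm4[of UNIV UNIV UNIV UNIV] by (simp add: theta_counting power4_eq_xxxx mult.assoc)
  ultimately show ?thesis by (simp add: counting_fps_times_3)
qed

text \<open>The two evaluations of the tetracode lattice are equated. The 8 is absorbed into
  \<open>2 * residue_theta 1\<close>, after which everything is a series in q^3 and one dilation can
  be undone.\<close>

lemma theta_power4: "theta ^ 4 = dilate theta * (dilate theta ^ 3 + fps_X * offset_theta ^ 3)"
proof (rule dilate_inj)
  have "8 * residue_theta 0 * residue_theta 1 ^ 3 = residue_theta 0 * (2 * residue_theta 1) ^ 3"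
    by (simp add: power_mult_distrib)
  then have "dilate (theta ^ 4) = residue_theta 0 ^ 4 + residue_theta 0 * (2 * residue_theta 1) ^ 3"
    using tetracode_lattice_theta by (simp only: theta_power4_dilate)
  also have "\<dots> = dilate (dilate theta * (dilate theta ^ 3 + fps_X * offset_theta ^ 3))"
    unfolding residue_theta_0 residue_theta_1
    by (simp add: dilate_mult dilate_add dilate_power dilate_X power_mult_distrib power3_eq_cube
        power4_eq_xxxx algebra_simps)
  finally show "dilate (theta ^ 4) = dilate (dilate theta * (dilate theta ^ 3 + fps_X * offset_theta ^ 3))" .
qed

text \<open>Write theta as u + q v with u, v series in q^3. Multiplying 1/theta by u^3 + q^3 v^3
  leaves u^2 - q u v + q^2 v^2, of which only the first term survives trisection. Hence the
  trisection of 1/theta is a^2 / (a^3 + q b^3), and by \<open>theta_power4\<close> the denominator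
  times \<open>a\<close> is \<open>theta ^ 4\<close>.\<close>

lemma trisect_overpartition_gf: "trisect overpartition_gf * theta ^ 4 = dilate theta ^ 3"
proof -
  define a b where "a = dilate theta" and "b = offset_theta"
  have "dilate (a ^ 3 + fps_X * b ^ 3) = theta * (dilate a ^ 2 - fps_X * dilate (a * b) + fps_X ^ 2 * dilate (b ^ 2))"
  proof -
    have "(u ^ 3 + fps_X ^ 3 * v ^ 3) = (u + fps_X * v) * (u ^ 2 - fps_X * (u * v) + fps_X ^ 2 * v ^ 2)"
      for u v :: "int fps" by (simp add: power2_eq_square power3_eq_cube algebra_simps)
    then show ?thesis
      unfolding theta_dissection[folded a_def b_def, symmetric]
      by (simp only: dilate_mult dilate_power dilate_add dilate_X) (simp only: theta_dissection[folded a_def b_def, symmetric])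
  qed
  then have "dilate (a ^ 3 + fps_X * b ^ 3) * overpartition_gf =
      (overpartition_gf * theta) * (dilate a ^ 2 - fps_X * dilate (a * b) + fps_X ^ 2 * dilate (b ^ 2))"
    by (simp add: ac_simps)
  then have "dilate (a ^ 3 + fps_X * b ^ 3) * overpartition_gf
      = dilate (a ^ 2) - fps_X ^ 1 * dilate (a * b) + fps_X ^ 2 * dilate (b ^ 2)"
    by (simp add: overpartition_gf_times_theta dilate_power)
  then have "trisect (dilate (a ^ 3 + fps_X * b ^ 3) * overpartition_gf)
      = trisect (dilate (a ^ 2)) - trisect (fps_X ^ 1 * dilate (a * b)) + trisect (fps_X ^ 2 * dilate (b ^ 2))"
    by (simp only: trisect_add trisect_diff)
  then have "(a ^ 3 + fps_X * b ^ 3) * trisect overpartition_gf = a ^ 2"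
    using trisect_X_power_dilate[of 1 "a * b"]
    by (simp only: trisect_dilate_mult trisect_dilate) (simp add: trisect_X_power_dilate)
  then have "a * ((a ^ 3 + fps_X * b ^ 3) * trisect overpartition_gf) = a ^ 3"
    by (simp add: power2_eq_square power3_eq_cube)
  then show ?thesis by (simp add: theta_power4 a_def b_def ac_simps)
qed

section \<open>Congruences between power series\<close>

lemma dvd_fps_iff: "(fps_const c dvd (F :: int fps)) \<longleftrightarrow> (\<forall>n. c dvd fps_nth F n)"
proof
  assume "\<forall>n. c dvd fps_nth F n"
  then obtain h where "\<And>n. fps_nth F n = c * h n" unfolding dvd_def by metis
  then have "F = fps_const c * Abs_fps h" by (intro fps_ext) simp
  then show "fps_const c dvd F" by simp
qed (auto simp: dvd_def)

text \<open>This is the Frobenius map modulo 3. Truncations are built up one monomial at a time: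
  mixed terms of a cube carry a factor 3, and the coefficients satisfy Fermat's congruence. A given
  coefficient sees only a truncation.\<close>

lemma fps_cube_cong: "3 dvd F ^ 3 - dilate F"
proof -
  have cutoff: "3 dvd fps_cutoff N F ^ 3 - dilate (fps_cutoff N F)" for N
  proof (induction N)
    case (Suc N)
    define T c where "T = fps_cutoff N F" and "c = fps_nth F N"
    define u where "u = fps_const c * fps_X ^ N"
    have cut: "fps_cutoff (Suc N) F = T + u"
      by (rule fps_ext) (auto simp: T_def u_def c_def less_Suc_eq fps_X_power_nth)
    have "u ^ 3 - dilate u = fps_const (c ^ 3 - c) * fps_X ^ (3 * N)"
    proof -
      have "dilate u = fps_const c * fps_X ^ (3 * N)"
        by (simp add: u_def dilate_mult dilate_power dilate_X dilate_const power_mult)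
      moreover have "u ^ 3 = fps_const (c ^ 3) * fps_X ^ (3 * N)"
        by (simp add: u_def power_mult_distrib fps_const_power power_mult[symmetric] mult.commute)
      ultimately show ?thesis by (simp add: algebra_simps flip: fps_const_sub)
    qed
    moreover have "3 dvd c ^ 3 - c"
    proof -
      have "c mod 3 = 0 \<or> c mod 3 = 1 \<or> c mod 3 = 2" by presburger
      then have "c ^ 3 mod 3 = c mod 3" using power_mod[of c 3 3] by auto
      then show ?thesis by (simp add: mod_eq_dvd_iff)
    qed
    then have "3 dvd fps_const (c ^ 3 - c)" by (auto simp: numeral_fps_const dvd_fps_iff)
    ultimately have "3 dvd u ^ 3 - dilate u" by simp
    then have "3 dvd (T ^ 3 - dilate T) + (u ^ 3 - dilate u) + 3 * (T\<^sup>2 * u + T * u\<^sup>2)"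
      using Suc.IH by (simp add: T_def)
    also have "(T ^ 3 - dilate T) + (u ^ 3 - dilate u) + 3 * (T\<^sup>2 * u + T * u\<^sup>2) = (T + u) ^ 3 - dilate (T + u)"
      by (simp add: dilate_add power2_eq_square power3_eq_cube algebra_simps)
    finally show ?case unfolding cut .
  qed (simp add: dilate_def)
  have "3 dvd fps_nth (F ^ 3 - dilate F) n" for n
  proof -
    define T where "T = fps_cutoff (Suc n) F"
    define R where "R = fps_shift (Suc n) F"
    have F: "F = T + fps_X ^ Suc n * R"
      unfolding T_def R_def by (metis add.commute fps_shift_cutoff mult.commute)
    define K where "K = 3 * T\<^sup>2 * R + 3 * T * R\<^sup>2 * fps_X ^ Suc n + R ^ 3 * (fps_X ^ Suc n)\<^sup>2"
    have "F ^ 3 = T ^ 3 + fps_X ^ Suc n * K"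
      unfolding F K_def by (simp add: power2_eq_square power3_eq_cube algebra_simps)
    then have "fps_nth (F ^ 3) n = fps_nth (T ^ 3) n" by (simp add: fps_X_power_mult_nth del: power_Suc)
    moreover have "fps_nth (dilate F) n = fps_nth (dilate T) n"
      by (auto simp: dilate_nth T_def)
    moreover have "3 dvd fps_nth (T ^ 3 - dilate T) n"
      using cutoff[of "Suc n"] unfolding T_def numeral_fps_const dvd_fps_iff by blast
    ultimately show ?thesis by simp
  qed
  then show ?thesis unfolding numeral_fps_const dvd_fps_iff by blast
qed

text \<open>In the cube of \<open>theta ^ 3 - 3 * H\<close> every term but the first is divisible by
  9, which lifts \<open>fps_cube_cong\<close> from modulus 3 to 9. Multiplying by the fourth power
  of the inverse of theta turns \<open>theta ^ 9\<close> into \<open>theta ^ 5\<close>.\<close>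

theorem overpartition_count_cong_theta:
  "9 dvd (-1) ^ n * int (overpartition_count (3 * n)) - fps_nth (theta ^ 5) n"
proof -
  obtain H where H: "theta ^ 3 - dilate theta = 3 * H" using fps_cube_cong by (auto elim: dvdE)
  then have "dilate theta = theta ^ 3 - 3 * H" by (simp add: algebra_simps)
  moreover have "(theta ^ 3 - 3 * H) ^ 3 = theta ^ 9 + 9 * (- (theta ^ 6 * H) + 3 * theta ^ 3 * H\<^sup>2 - 3 * H ^ 3)"
    by (simp add: algebra_simps eval_nat_numeral)
  ultimately have "dilate theta ^ 3 = theta ^ 9 + 9 * (- (theta ^ 6 * H) + 3 * theta ^ 3 * H\<^sup>2 - 3 * H ^ 3)"
    by simp
  then obtain K where K: "trisect overpartition_gf * theta ^ 4 = theta ^ 9 + 9 * K"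
    unfolding trisect_overpartition_gf by blast
  have inv: "overpartition_gf ^ 4 * theta ^ 4 = 1"
    by (simp add: overpartition_gf_times_theta flip: power_mult_distrib)
  have "trisect overpartition_gf = overpartition_gf ^ 4 * (trisect overpartition_gf * theta ^ 4)"
    using inv by (simp add: ac_simps)
  also have "\<dots> = overpartition_gf ^ 4 * theta ^ 4 * theta ^ 5 + 9 * (overpartition_gf ^ 4 * K)"
    unfolding K by (simp add: algebra_simps power_add[symmetric])
  finally have "trisect overpartition_gf - theta ^ 5 = 9 * (overpartition_gf ^ 4 * K)"
    by (simp add: inv)
  then have "9 dvd fps_nth (trisect overpartition_gf - theta ^ 5) n"
    by (simp add: numeral_fps_const)
  then show ?thesis by (simp add: trisect_def overpartition_gf_def minus_one_power_iff)
qed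

section \<open>Unimodular lattices of rank at most 5\<close>

definition quad :: "int mat \<Rightarrow> int vec \<Rightarrow> int" where
  "quad G x = x \<bullet> (G *\<^sub>v x)"

definition unimodular :: "nat \<Rightarrow> int mat \<Rightarrow> bool" where
  "unimodular n U \<longleftrightarrow> U \<in> carrier_mat n n \<and> \<bar>det U\<bar> = 1"

definition pos_def :: "nat \<Rightarrow> int mat \<Rightarrow> bool" where
  "pos_def n G \<longleftrightarrow> G \<in> carrier_mat n n \<and> transpose_mat G = G \<and>
     (\<forall>x\<in>carrier_vec n. x \<noteq> 0\<^sub>v n \<longrightarrow> 0 < quad G x)"

text \<open>The block matrix with corner \<open>a\<close>, first row continued by \<open>r\<close>,
  first column continued by \<open>c\<close>, and remaining block \<open>D\<close>. Using
  \<open>vCons\<close> matches the decomposition of vectors in inductions on the dimension.\<close>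

definition bordered :: "'a \<Rightarrow> 'a vec \<Rightarrow> 'a vec \<Rightarrow> 'a mat \<Rightarrow> 'a mat" where
  "bordered a r c D = mat (Suc (dim_vec c)) (Suc (dim_vec r))
     (\<lambda>(i, j). case i of 0 \<Rightarrow> vCons a r $ j | Suc k \<Rightarrow> vCons (c $ k) (row D k) $ j)"

lemma carrier_vec_SucE:
  assumes "x \<in> carrier_vec (Suc n)"
  obtains t y where "x = vCons t y" "y \<in> carrier_vec n"
  using assms by (cases x) auto

lemma bordered_carrier [simp]:
  "r \<in> carrier_vec n \<Longrightarrow> c \<in> carrier_vec n \<Longrightarrow> bordered a r c D \<in> carrier_mat (Suc n) (Suc n)"
  by (auto simp: bordered_def)

lemma bordered_mult_vCons:
  assumes "r \<in> carrier_vec n" "c \<in> carrier_vec n" "D \<in> carrier_mat n n" "y \<in> carrier_vec n"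
  shows "bordered a r c D *\<^sub>v vCons t y = vCons (a * t + r \<bullet> y) (t \<cdot>\<^sub>v c + D *\<^sub>v (y :: 'a :: comm_ring_1 vec))"
proof (rule eq_vecI)
  fix i assume "i < dim_vec (vCons (a * t + r \<bullet> y) (t \<cdot>\<^sub>v c + D *\<^sub>v y))"
  then have i: "i < Suc n" using assms by auto
  have "row (bordered a r c D) i = (case i of 0 \<Rightarrow> vCons a r | Suc k \<Rightarrow> vCons (c $ k) (row D k))"
    using i assms by (intro eq_vecI) (auto simp: bordered_def split: nat.splits)
  with i show "(bordered a r c D *\<^sub>v vCons t y) $ i = vCons (a * t + r \<bullet> y) (t \<cdot>\<^sub>v c + D *\<^sub>v y) $ i"
    using assms by (auto simp: bordered_def ac_simps split: nat.splits)
qed (use assms in \<open>auto simp: bordered_def\<close>)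

lemma det_bordered_upper:
  fixes D :: "int mat"
  assumes "r \<in> carrier_vec n" "D \<in> carrier_mat n n"
  shows "det (bordered a r (0\<^sub>v n) D) = a * det D"
proof -
  have "bordered a r (0\<^sub>v n) D = four_block_mat (mat 1 1 (\<lambda>_. a)) (mat 1 n (\<lambda>(i, j). r $ j)) (0\<^sub>m n 1) D"
    using assms by (intro eq_matI) (auto simp: bordered_def four_block_mat_def Let_def vec_index_vCons split: nat.splits)
  also have "det \<dots> = det (mat 1 1 (\<lambda>_. a)) * det D"
    using assms by (intro det_four_block_mat_lower_left_zero_col) auto
  also have "det (mat 1 1 (\<lambda>_. a)) = a" by (subst det_single) auto
  finally show ?thesis .
qed

lemma transpose_bordered:
  assumes "r \<in> carrier_vec n" "c \<in> carrier_vec n" "D \<in> carrier_mat n n"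
  shows "transpose_mat (bordered a r c D) = bordered a c r (transpose_mat D)"
  using assms by (intro eq_matI) (auto simp: bordered_def vec_index_vCons split: nat.splits)

lemma det_bordered_lower:
  fixes D :: "int mat"
  assumes "c \<in> carrier_vec n" "D \<in> carrier_mat n n"
  shows "det (bordered a (0\<^sub>v n) c D) = a * det D"
proof -
  have "det (bordered a (0\<^sub>v n) c D) = det (transpose_mat (bordered a (0\<^sub>v n) c D))"
    using assms by (intro det_transpose[symmetric, of _ "Suc n"]) auto
  also have "\<dots> = a * det (transpose_mat D)"
    using assms by (simp add: transpose_bordered[of _ n] det_bordered_upper)
  finally show ?thesis using det_transpose[OF assms(2)] by simp
qed

lemma symmetric_borderedE:
  fixes G :: "'a :: comm_ring_1 mat"
  assumes "G \<in> carrier_mat (Suc n) (Suc n)" "transpose_mat G = G"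
  obtains m b C where "b \<in> carrier_vec n" "C \<in> carrier_mat n n" "transpose_mat C = C"
    "G = bordered m b b C"
proof
  let ?b = "vec n (\<lambda>i. G $$ (0, Suc i))" and ?C = "mat n n (\<lambda>(i, j). G $$ (Suc i, Suc j))"
  have sym: "G $$ (i, j) = G $$ (j, i)" if "i < Suc n" "j < Suc n" for i j
    using assms that by (metis carrier_matD index_transpose_mat(1))
  show "?b \<in> carrier_vec n" "?C \<in> carrier_mat n n" by auto
  show "transpose_mat ?C = ?C" by (intro eq_matI) (auto simp: sym)
  show "G = bordered (G $$ (0, 0)) ?b ?b ?C"
    using assms sym by (intro eq_matI) (auto simp: bordered_def vec_index_vCons split: nat.splits)
qed

text \<open>This is \<open>m\<close> times the Schur complement, so that it stays integral.\<close>

definition schur :: "int \<Rightarrow> int vec \<Rightarrow> int mat \<Rightarrow> int mat" where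
  "schur m b C = mat (dim_vec b) (dim_vec b) (\<lambda>(i, j). m * C $$ (i, j) - b $ i * b $ j)"

lemma schur_carrier [simp]: "b \<in> carrier_vec n \<Longrightarrow> schur m b C \<in> carrier_mat n n"
  by (auto simp: schur_def)

lemma schur_symmetric:
  assumes "b \<in> carrier_vec n" "C \<in> carrier_mat n n" "transpose_mat C = C"
  shows "transpose_mat (schur m b C) = schur m b C"
proof -
  have "C $$ (i, j) = C $$ (j, i)" if "i < n" "j < n" for i j
    using assms that by (metis carrier_matD index_transpose_mat(1))
  then show ?thesis using assms by (intro eq_matI) (auto simp: schur_def)
qed

lemma schur_mult_vec:
  assumes "b \<in> carrier_vec n" "C \<in> carrier_mat n n" "y \<in> carrier_vec n"
  shows "schur m b C *\<^sub>v y = m \<cdot>\<^sub>v (C *\<^sub>v y) - (b \<bullet> y) \<cdot>\<^sub>v b"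
  using assms
  by (intro eq_vecI)
     (auto simp: schur_def scalar_prod_def sum_distrib_left sum_distrib_right sum_subtractf algebra_simps)

text \<open>Completing the square in the first variable, multiplied by \<open>m\<close> to avoid
  fractions.\<close>

lemma quad_bordered:
  assumes "b \<in> carrier_vec n" "C \<in> carrier_mat n n" "y \<in> carrier_vec n"
  shows "m * quad (bordered m b b C) (vCons t y) = (m * t + b \<bullet> y)\<^sup>2 + quad (schur m b C) y"
proof -
  have 1: "quad (bordered m b b C) (vCons t y) = t * (m * t + b \<bullet> y) + (t * (b \<bullet> y) + y \<bullet> (C *\<^sub>v y))"
    using assms comm_scalar_prod[of y n b]
    by (simp add: quad_def bordered_mult_vCons[of _ n] scalar_prod_add_distrib[of _ n])
  have 2: "quad (schur m b C) y = m * (y \<bullet> (C *\<^sub>v y)) - (b \<bullet> y)\<^sup>2"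
    using assms comm_scalar_prod[of y n b]
    by (simp add: quad_def schur_mult_vec[of _ n] scalar_prod_minus_distrib[of _ n] power2_eq_square)
  show ?thesis unfolding 1 2 by (simp add: power2_eq_square algebra_simps)
qed

lemma det_schur:
  assumes b: "b \<in> carrier_vec n" and C: "C \<in> carrier_mat n n"
  shows "m ^ n * det (bordered m b b C) = m * det (schur m b C)"
proof -
  \<comment> \<open>Left multiplication by \<open>?L\<close> replaces each lower row by
    \<open>m\<close> times itself minus a multiple of the first row, which clears the first column
    at the cost of a factor m^n in the determinant.\<close>
  let ?L = "bordered 1 (0\<^sub>v n) (- b) (m \<cdot>\<^sub>m 1\<^sub>m n)"
  have L: "?L \<in> carrier_mat (Suc n) (Suc n)" and G: "bordered m b b C \<in> carrier_mat (Suc n) (Suc n)"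
    using assms by auto
  have R: "row ?L i = (case i of 0 \<Rightarrow> vCons 1 (0\<^sub>v n) | Suc k \<Rightarrow> vCons (- b $ k) (m \<cdot>\<^sub>v unit_vec n k))"
    if "i < Suc n" for i
    using that b by (intro eq_vecI) (auto simp: bordered_def vec_index_vCons split: nat.splits)
  have K: "col (bordered m b b C) j = (case j of 0 \<Rightarrow> vCons m b | Suc k \<Rightarrow> vCons (b $ k) (col C k))"
    if "j < Suc n" for j
    using that b C by (intro eq_vecI) (auto simp: bordered_def vec_index_vCons split: nat.splits)
  have "?L * bordered m b b C = bordered m b (0\<^sub>v n) (schur m b C)"
  proof (rule eq_matI)
    fix i j assume "i < dim_row (bordered m b (0\<^sub>v n) (schur m b C))" "j < dim_col (bordered m b (0\<^sub>v n) (schur m b C))"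
    then have ij: "i < Suc n" "j < Suc n" using b by (auto simp: bordered_def)
    then have "(?L * bordered m b b C) $$ (i, j) = row ?L i \<bullet> col (bordered m b b C) j"
      using L G by (intro index_mult_mat) auto
    also have "\<dots> = bordered m b (0\<^sub>v n) (schur m b C) $$ (i, j)"
      unfolding R[OF ij(1)] K[OF ij(2)] using ij b C
      by (auto simp: bordered_def schur_def vec_index_vCons split: nat.splits)
    finally show "(?L * bordered m b b C) $$ (i, j) = bordered m b (0\<^sub>v n) (schur m b C) $$ (i, j)" .
  qed (use b in \<open>auto simp: bordered_def\<close>)
  then have "det ?L * det (bordered m b b C) = det (bordered m b (0\<^sub>v n) (schur m b C))"
    using det_mult[OF L G] by simp
  moreover have "det ?L = m ^ n"
    using b by (subst det_bordered_lower) (auto simp: det_smult)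
  moreover have "det (bordered m b (0\<^sub>v n) (schur m b C)) = m * det (schur m b C)"
    using b by (intro det_bordered_upper) auto
  ultimately show ?thesis by simp
qed

lemma pos_def_corner:
  assumes "pos_def (Suc n) (bordered m b b C)" "b \<in> carrier_vec n" "C \<in> carrier_mat n n"
  shows "0 < m"
proof -
  have "vCons 1 (0\<^sub>v n) \<noteq> (0\<^sub>v (Suc n) :: int vec)" by (simp add: zero_vec_Suc)
  then have "0 < quad (bordered m b b C) (vCons 1 (0\<^sub>v n))"
    using assms unfolding pos_def_def by auto
  also have "\<dots> = m"
  proof -
    have "C *\<^sub>v 0\<^sub>v n = 0\<^sub>v n" using assms(3) by auto
    then show ?thesis using assms by (simp add: quad_def bordered_mult_vCons[of _ n])
  qed
  finally show ?thesis .
qed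

lemma quad_smult:
  assumes "G \<in> carrier_mat n n" "x \<in> carrier_vec n"
  shows "quad G (c \<cdot>\<^sub>v x) = c\<^sup>2 * quad G x"
proof -
  have "G *\<^sub>v (c \<cdot>\<^sub>v x) = c \<cdot>\<^sub>v (G *\<^sub>v x)" using assms by (intro eq_vecI) auto
  then show ?thesis using assms by (simp add: quad_def power2_eq_square)
qed

lemma pos_def_schur:
  assumes G: "pos_def (Suc n) (bordered m b b C)"
    and b: "b \<in> carrier_vec n" and C: "C \<in> carrier_mat n n" "transpose_mat C = C"
  shows "pos_def n (schur m b C)"
  unfolding pos_def_def
proof (intro conjI ballI impI)
  fix y :: "int vec" assume y: "y \<in> carrier_vec n" "y \<noteq> 0\<^sub>v n"
  have m: "0 < m" using pos_def_corner[OF G b C(1)] .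
  have "m \<cdot>\<^sub>v y \<noteq> 0\<^sub>v n"
  proof
    assume "m \<cdot>\<^sub>v y = 0\<^sub>v n"
    then have "(m \<cdot>\<^sub>v y) $ i = 0" if "i < n" for i using that by simp
    then have "y $ i = 0" if "i < n" for i using that m y by auto
    then have "y = 0\<^sub>v n" using y by (intro eq_vecI) auto
    with y show False by simp
  qed
  \<comment> \<open>With this first entry the square in \<open>quad_bordered\<close> vanishes and
    only the Schur complement remains.\<close>
  then have "vCons (- (b \<bullet> y)) (m \<cdot>\<^sub>v y) \<noteq> 0\<^sub>v (Suc n)" by (simp add: zero_vec_Suc)
  then have "0 < quad (bordered m b b C) (vCons (- (b \<bullet> y)) (m \<cdot>\<^sub>v y))"
    using G y unfolding pos_def_def by auto
  then have "0 < m * quad (bordered m b b C) (vCons (- (b \<bullet> y)) (m \<cdot>\<^sub>v y))" using m by simp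
  also have "\<dots> = m\<^sup>2 * quad (schur m b C) y"
    using b C y by (subst quad_bordered) (auto simp: quad_smult[of _ n])
  finally show "0 < quad (schur m b C) y" using m by (simp add: zero_less_mult_iff)
qed (use b C in \<open>auto intro: schur_symmetric\<close>)

section \<open>Change of basis and primitive vectors\<close>

lemma unimodular_mult:
  "unimodular n U \<Longrightarrow> unimodular n V \<Longrightarrow> unimodular n (U * V)"
  by (auto simp: unimodular_def det_mult abs_mult)

lemma unimodular_inverse:
  assumes "unimodular n U"
  obtains V where "unimodular n V" "U * V = 1\<^sub>m n" "V * U = 1\<^sub>m n"
proof
  have U: "U \<in> carrier_mat n n" and d: "\<bar>det U\<bar> = 1" using assms by (auto simp: unimodular_def)
  let ?V = "det U \<cdot>\<^sub>m adj_mat U"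
  have dd: "det U * det U = 1" using d by (auto simp: abs_if split: if_splits)
  note A = adj_mat[OF U]
  show UV: "U * ?V = 1\<^sub>m n"
    using A dd U by (auto simp: mult_smult_distrib[OF U A(1)])
  show "?V * U = 1\<^sub>m n"
    using A dd U by (auto simp: mult_smult_assoc_mat[OF A(1) U])
  have V: "?V \<in> carrier_mat n n" using A by auto
  have "det U * det ?V = 1" using UV det_mult[OF U V] by simp
  then have "\<bar>det ?V\<bar> = 1" using d by (metis abs_mult abs_one mult_1)
  then show "unimodular n ?V" using V by (auto simp: unimodular_def)
qed

lemma unimodular_bordered:
  "unimodular n W \<Longrightarrow> r \<in> carrier_vec n \<Longrightarrow> unimodular (Suc n) (bordered 1 r (0\<^sub>v n) W)"
  by (auto simp: unimodular_def det_bordered_upper)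

lemma scalar_prod_mult_mat_vec:
  fixes A :: "'a :: comm_ring_1 mat"
  assumes A: "A \<in> carrier_mat n n" and "x \<in> carrier_vec n" "y \<in> carrier_vec n"
  shows "(A *\<^sub>v x) \<bullet> y = x \<bullet> (transpose_mat A *\<^sub>v y)"
proof -
  have "(A *\<^sub>v x) \<bullet> y = y \<bullet> (A *\<^sub>v x)" using assms by (intro comm_scalar_prod[of _ n]) auto
  also have "\<dots> = vec n (\<lambda>j. y \<bullet> col A j) \<bullet> x"
    using assoc_scalar_prod[OF assms(3) A assms(2)] A by (simp add: mult_mat_vec_def)
  also have "vec n (\<lambda>j. y \<bullet> col A j) = transpose_mat A *\<^sub>v y"
    using assms by (intro eq_vecI) (auto intro: comm_scalar_prod[of _ n])
  also have "\<dots> \<bullet> x = x \<bullet> (transpose_mat A *\<^sub>v y)"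
    using assms by (intro comm_scalar_prod[of _ n]) auto
  finally show ?thesis .
qed

lemma quad_congruent:
  assumes "G \<in> carrier_mat n n" "U \<in> carrier_mat n n" "x \<in> carrier_vec n"
  shows "quad (transpose_mat U * G * U) x = quad G (U *\<^sub>v x)"
proof -
  have "transpose_mat U * G * U *\<^sub>v x = transpose_mat U *\<^sub>v (G *\<^sub>v (U *\<^sub>v x))"
    using assms by (simp add: assoc_mult_mat_vec[of _ n n _ n])
  then show ?thesis
    using assms scalar_prod_mult_mat_vec[of U n x "G *\<^sub>v (U *\<^sub>v x)"] by (simp add: quad_def)
qed

lemma pos_def_congruent:
  assumes G: "pos_def n G" and U: "unimodular n U"
  shows "pos_def n (transpose_mat U * G * U)" "det (transpose_mat U * G * U) = det G"
proof -
  have c: "G \<in> carrier_mat n n" "U \<in> carrier_mat n n" and s: "transpose_mat G = G"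
    using assms by (auto simp: pos_def_def unimodular_def)
  obtain V where V: "unimodular n V" "V * U = 1\<^sub>m n" using unimodular_inverse[OF U] by metis
  then have cV: "V \<in> carrier_mat n n" by (auto simp: unimodular_def)
  show "pos_def n (transpose_mat U * G * U)"
    unfolding pos_def_def
  proof (intro conjI ballI impI)
    show "transpose_mat (transpose_mat U * G * U) = transpose_mat U * G * U"
      using c s by (simp add: transpose_mult[of _ n n _ n] assoc_mult_mat[of _ n n _ n _ n])
  next
    fix x :: "int vec" assume x: "x \<in> carrier_vec n" "x \<noteq> 0\<^sub>v n"
    have "U *\<^sub>v x \<noteq> 0\<^sub>v n"
    proof
      assume "U *\<^sub>v x = 0\<^sub>v n"
      then have "(V * U) *\<^sub>v x = V *\<^sub>v 0\<^sub>v n" using c cV x by (simp add: assoc_mult_mat_vec[of _ n n _ n])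
      moreover have "V *\<^sub>v 0\<^sub>v n = 0\<^sub>v n" using cV by auto
      ultimately show False using V x by simp
    qed
    then show "0 < quad (transpose_mat U * G * U) x"
      using G c x by (subst quad_congruent) (auto simp: pos_def_def)
  qed (use c in auto)
  have "det (transpose_mat U * G * U) = det U * det G * det U"
    using c by (simp add: det_mult[of _ n] det_transpose[of _ n])
  also have "\<dots> = det G" using U by (auto simp: unimodular_def abs_if split: if_splits)
  finally show "det (transpose_mat U * G * U) = det G" .
qed

text \<open>Being the first column of a unimodular matrix; this makes a completion to a basis available
  without any gcd argument.\<close>

definition primitive :: "nat \<Rightarrow> int vec \<Rightarrow> bool" where
  "primitive n x \<longleftrightarrow> (\<exists>U. unimodular n U \<and> x = U *\<^sub>v unit_vec n 0)"

lemma primitive_mult: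
  assumes "unimodular n U" "primitive n x" shows "primitive n (U *\<^sub>v x)"
proof -
  obtain V where V: "unimodular n V" "x = V *\<^sub>v unit_vec n 0" using assms by (auto simp: primitive_def)
  then have "U *\<^sub>v x = (U * V) *\<^sub>v unit_vec n 0"
    using assms by (auto simp: unimodular_def assoc_mult_mat_vec[of _ n n _ n])
  then show ?thesis using unimodular_mult[OF assms(1) V(1)] by (auto simp: primitive_def)
qed

lemma unit_vec_Suc_0: "unit_vec (Suc n) 0 = vCons 1 (0\<^sub>v n)"
  by (intro eq_vecI) (auto simp: unit_vec_def vec_index_vCons)

lemma unimodular_one: "unimodular n (1\<^sub>m n)"
  by (auto simp: unimodular_def)

lemma primitive_unit: "primitive n (unit_vec n 0)"
  using unimodular_one[of n] unfolding primitive_def by (intro exI[of _ "1\<^sub>m n"]) auto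

text \<open>A swap sends the first unit vector to the second, which the bordered completion of
  \<open>y\<close> then sends to \<open>vCons t y\<close>.\<close>

lemma primitive_vCons:
  assumes "primitive n y" "0 < n" shows "primitive (Suc n) (vCons t y)"
proof -
  obtain V where V: "unimodular n V" "y = V *\<^sub>v unit_vec n 0" using assms by (auto simp: primitive_def)
  let ?P = "swaprows_mat (Suc n) 0 1 :: int mat"
  let ?U = "bordered 1 (t \<cdot>\<^sub>v unit_vec n 0) (0\<^sub>v n) V"
  have P: "unimodular (Suc n) ?P"
    using assms by (auto simp: unimodular_def det_swaprows_mat)
  have U: "unimodular (Suc n) ?U" using V by (intro unimodular_bordered) auto
  have "?P *\<^sub>v unit_vec (Suc n) 0 = vCons 0 (unit_vec n 0)"
    using assms by (intro eq_vecI) (auto simp: vec_index_vCons)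
  moreover have "?U *\<^sub>v vCons 0 (unit_vec n 0) = vCons t y"
  proof -
    have "V \<in> carrier_mat n n" using V by (auto simp: unimodular_def)
    moreover have "0 \<cdot>\<^sub>v 0\<^sub>v n = (0\<^sub>v n :: int vec)" by auto
    ultimately show ?thesis
      using V assms by (auto simp: bordered_mult_vCons[of _ n])
  qed
  moreover have "?U *\<^sub>v (?P *\<^sub>v unit_vec (Suc n) 0) = (?U * ?P) *\<^sub>v unit_vec (Suc n) 0"
    using U P by (auto simp: unimodular_def assoc_mult_mat_vec[of _ "Suc n" "Suc n" _ "Suc n"])
  ultimately show ?thesis
    using unimodular_mult[OF U P] by (auto simp: primitive_def)
qed

lemma primitive_carrier: "primitive n x \<Longrightarrow> x \<in> carrier_vec n"
  by (auto simp: primitive_def unimodular_def)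

lemma quad_unit_bordered:
  assumes "b \<in> carrier_vec n" "C \<in> carrier_mat n n"
  shows "quad (bordered m b b C) (unit_vec (Suc n) 0) = m"
proof -
  have "C *\<^sub>v 0\<^sub>v n = 0\<^sub>v n" using assms by auto
  then show ?thesis
    using assms by (simp add: quad_def bordered_mult_vCons[of _ n] unit_vec_Suc_0)
qed

section \<open>Hermite reduction and orthonormal bases\<close>

lemma nearest_multiple:
  fixes m a :: int
  assumes "0 < m" obtains t where "4 * (m * t + a)\<^sup>2 \<le> m\<^sup>2"
proof
  \<comment> \<open>The quotient is a/m rounded to a nearest integer, so the remaining distance is
    at most m/2.\<close>
  let ?t = "- ((2 * a + m) div (2 * m))"
  have "(2 * a + m) mod (2 * m) = (2 * a + m) + 2 * m * ?t"
    by (simp add: minus_div_mult_eq_mod[symmetric] algebra_simps)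
  moreover have "0 \<le> (2 * a + m) mod (2 * m)" "(2 * a + m) mod (2 * m) < 2 * m" using assms by auto
  ultimately have "\<bar>2 * (m * ?t + a)\<bar> \<le> m" by (simp only: abs_le_iff) (simp add: algebra_simps)
  then have "(2 * (m * ?t + a))\<^sup>2 \<le> m\<^sup>2" using assms by (simp only: power2_le_iff_abs_le)
  then show "4 * (m * ?t + a)\<^sup>2 \<le> m\<^sup>2" by (simp only: power_mult_distrib) simp
qed

text \<open>In rank N = n + 1 this says that some primitive vector has norm at most (4/3)^((N-1)/2)
  times the N-th root of the determinant, with roots and denominators cleared. A shortest primitive
  vector of norm \<open>m\<close> is split off; a short vector of the projected lattice, lifted as
  close to the orthogonal complement as possible, cannot be shorter than \<open>m\<close>.\<close>

lemma hermite_bound: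
  assumes "pos_def (Suc n) G"
  shows "\<exists>x. primitive (Suc n) x \<and>
    3 ^ (\<Sum>i\<le>n. i) * quad G x ^ Suc n \<le> 4 ^ (\<Sum>i\<le>n. i) * det G"
  using assms
proof (induction n arbitrary: G)
  case 0
  then have G: "G \<in> carrier_mat 1 1" by (auto simp: pos_def_def)
  have "quad G (unit_vec 1 0) = det G"
    using G by (subst det_single) (auto simp: quad_def scalar_prod_def)
  then show ?case using primitive_unit[of 1] by (intro exI[of _ "unit_vec 1 0"]) auto
next
  case (Suc n)
  let ?N = "Suc (Suc n)"
  define e where "e = (\<Sum>i\<le>n. i)"
  \<comment> \<open>Minimising over primitive vectors rather than nonzero ones makes the minimiser
    the first vector of a basis at once.\<close>
  obtain x where x: "primitive ?N x" and min: "\<And>z. primitive ?N z \<Longrightarrow> nat (quad G x) \<le> nat (quad G z)"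
    using ex_has_least_nat[of "primitive ?N" "unit_vec ?N 0" "\<lambda>x. nat (quad G x)"] primitive_unit by auto
  obtain U where U: "unimodular ?N U" "x = U *\<^sub>v unit_vec ?N 0" using x by (auto simp: primitive_def)
  define G' where "G' = transpose_mat U * G * U"
  have G': "pos_def ?N G'" "det G' = det G"
    using pos_def_congruent[OF Suc.prems U(1)] by (auto simp: G'_def)
  then obtain m b C where bC: "b \<in> carrier_vec (Suc n)" "C \<in> carrier_mat (Suc n) (Suc n)"
      "transpose_mat C = C" and G'_eq: "G' = bordered m b b C"
    by (auto simp: pos_def_def elim: symmetric_borderedE)
  have quadG': "quad G' z = quad G (U *\<^sub>v z)" if "z \<in> carrier_vec ?N" for z
    using that U(1) Suc.prems by (auto simp: G'_def unimodular_def pos_def_def intro: quad_congruent)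
  have m: "0 < m" using pos_def_corner G'(1) bC unfolding G'_eq by blast
  have mx: "quad G x = m"
    using quadG'[of "unit_vec ?N 0"] quad_unit_bordered[OF bC(1,2)] by (simp add: G'_eq U(2))
  have S: "pos_def (Suc n) (schur m b C)"
    using pos_def_schur G'(1) bC unfolding G'_eq by blast
  from Suc.IH[OF S] obtain y where y: "primitive (Suc n) y"
    and bound: "3 ^ e * quad (schur m b C) y ^ Suc n \<le> 4 ^ e * det (schur m b C)"
    unfolding e_def by auto
  define s where "s = quad (schur m b C) y"
  have yc: "y \<in> carrier_vec (Suc n)" using y by (rule primitive_carrier)
  \<comment> \<open>This lift of \<open>y\<close> has first component at most m/2, so minimality
    gives m^2 <= m^2/4 + s, that is 3 m^2 <= 4 s.\<close>
  obtain t where t: "4 * (m * t + b \<bullet> y)\<^sup>2 \<le> m\<^sup>2" using nearest_multiple[OF m] .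
  have "m \<le> quad G' (vCons t y)"
  proof -
    have "primitive ?N (U *\<^sub>v vCons t y)" using primitive_mult[OF U(1)] primitive_vCons[OF y] by simp
    from min[OF this] show ?thesis using m mx quadG'[of "vCons t y"] yc by simp
  qed
  then have "m * m \<le> m * quad G' (vCons t y)" using m by simp
  also have "\<dots> = (m * t + b \<bullet> y)\<^sup>2 + s"
    unfolding G'_eq s_def by (rule quad_bordered[OF bC(1,2) yc])
  finally have ms: "3 * m\<^sup>2 \<le> 4 * s" using t by (simp add: power2_eq_square)
  have dS: "det (schur m b C) = m ^ n * det G"
    using det_schur[OF bC(1,2), of m] m G' unfolding G'_eq by simp
  \<comment> \<open>The factor m^n matches the determinant m^n det G of the Schur complement and is
    cancelled at the end.\<close>
  have "m ^ n * (3 ^ (e + Suc n) * m ^ ?N) = 3 ^ e * (3 * m\<^sup>2) ^ Suc n"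
    by (simp add: power_add power_mult_distrib power_mult[symmetric] power2_eq_square)
  also have "\<dots> \<le> 3 ^ e * (4 * s) ^ Suc n"
    using ms m by (intro mult_left_mono power_mono) auto
  also have "\<dots> = 4 ^ Suc n * (3 ^ e * s ^ Suc n)" by (simp add: power_mult_distrib)
  also have "\<dots> \<le> 4 ^ Suc n * (4 ^ e * (m ^ n * det G))"
    using bound unfolding s_def dS by (intro mult_left_mono) auto
  also have "\<dots> = m ^ n * (4 ^ (e + Suc n) * det G)" by (simp add: power_add)
  finally have "3 ^ (e + Suc n) * m ^ ?N \<le> 4 ^ (e + Suc n) * det G" using m by simp
  then show ?case using x mx unfolding e_def by (intro exI[of _ x]) simp
qed

text \<open>Hermite's bound forces a primitive vector of norm 1. With corner 1 the Schur complement
  is the form on the orthogonal complement itself, again integral of determinant 1, and the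
  induction continues there.\<close>

theorem unimodular_lattice_orthonormal_basis:
  assumes "pos_def n G" "det G = 1" "n \<le> 5"
  shows "\<exists>U. unimodular n U \<and> (\<forall>x\<in>carrier_vec n. quad G (U *\<^sub>v x) = x \<bullet> x)"
  using assms
proof (induction n arbitrary: G)
  case 0
  have "quad G (1\<^sub>m 0 *\<^sub>v x) = x \<bullet> x" if "x \<in> carrier_vec 0" for x
    using that by (auto simp: quad_def scalar_prod_def)
  then show ?case using unimodular_one by blast
next
  case (Suc n)
  let ?N = "Suc n"
  obtain x where x: "primitive ?N x"
    and bound: "3 ^ (\<Sum>i\<le>n. i) * quad G x ^ ?N \<le> 4 ^ (\<Sum>i\<le>n. i)"
    using hermite_bound[OF Suc.prems(1)] Suc.prems(2) by auto
  obtain U where U: "unimodular ?N U" "x = U *\<^sub>v unit_vec ?N 0" using x by (auto simp: primitive_def)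
  define G' where "G' = transpose_mat U * G * U"
  have G': "pos_def ?N G'" "det G' = 1"
    using pos_def_congruent[OF Suc.prems(1) U(1)] Suc.prems(2) by (auto simp: G'_def)
  then obtain m b C where bC: "b \<in> carrier_vec n" "C \<in> carrier_mat n n"
      "transpose_mat C = C" and G'_eq: "G' = bordered m b b C"
    by (auto simp: pos_def_def elim: symmetric_borderedE)
  have quadG': "quad G' z = quad G (U *\<^sub>v z)" if "z \<in> carrier_vec ?N" for z
    using that U(1) Suc.prems by (auto simp: G'_def unimodular_def pos_def_def intro: quad_congruent)
  have mx: "quad G x = m"
    using quadG'[of "unit_vec ?N 0"] quad_unit_bordered[OF bC(1,2)] by (simp add: G'_eq U(2))
  have m: "0 < m" using pos_def_corner G'(1) bC unfolding G'_eq by blast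
  \<comment> \<open>Hermite's constant \<open>(4/3)\<^bsup>(N-1)/2\<^esup>\<close> is less than 2 exactly for \<open>N \<le> 5\<close>.\<close>
  have "m = 1"
  proof (rule ccontr)
    assume "m \<noteq> 1"
    then have "2 ^ ?N \<le> m ^ ?N" using m by (intro power_mono) auto
    then have "3 ^ (\<Sum>i\<le>n. i) * 2 ^ ?N \<le> (4 :: int) ^ (\<Sum>i\<le>n. i)"
      using bound mx by (smt (verit) mult_left_mono zero_le_power)
    moreover have "n \<in> {0, 1, 2, 3, 4}" using Suc.prems(3) by auto
    ultimately show False by (auto simp: eval_nat_numeral)
  qed
  note G'_eq = G'_eq[unfolded \<open>m = 1\<close>]
  have S: "pos_def n (schur 1 b C)" using pos_def_schur G'(1) bC unfolding G'_eq by blast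
  have "det (schur 1 b C) = 1" using det_schur[OF bC(1,2), of 1] G'(2) G'_eq by simp
  from Suc.IH[OF S this] Suc.prems(3) obtain W where W: "unimodular n W"
    and Wq: "\<And>y. y \<in> carrier_vec n \<Longrightarrow> quad (schur 1 b C) (W *\<^sub>v y) = y \<bullet> y" by auto
  have Wc: "W \<in> carrier_mat n n" using W by (auto simp: unimodular_def)
  \<comment> \<open>Chosen so that \<open>?r \<bullet> y\<close> cancels
    \<open>b \<bullet> (W *\<^sub>v y)\<close> in the completed square: the lifted basis becomes
    orthogonal to the split-off vector.\<close>
  let ?r = "- (transpose_mat W *\<^sub>v b)"
  let ?V = "bordered 1 ?r (0\<^sub>v n) W"
  have r: "?r \<in> carrier_vec n" using Wc bC by auto
  have V: "unimodular ?N ?V" using W r by (rule unimodular_bordered)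
  have "quad G ((U * ?V) *\<^sub>v z) = z \<bullet> z" if z: "z \<in> carrier_vec ?N" for z
  proof -
    obtain t y where zy: "z = vCons t y" and y: "y \<in> carrier_vec n" using z by (elim carrier_vec_SucE)
    have "quad G ((U * ?V) *\<^sub>v z) = quad G' (?V *\<^sub>v z)"
      using z U V by (subst quadG') (auto simp: unimodular_def assoc_mult_mat_vec[of _ ?N ?N _ ?N])
    also have "?V *\<^sub>v z = vCons (t + ?r \<bullet> y) (W *\<^sub>v y)"
    proof -
      have "t \<cdot>\<^sub>v 0\<^sub>v n = (0\<^sub>v n :: int vec)" by auto
      then show ?thesis using y Wc r unfolding zy by (subst bordered_mult_vCons[of _ n]) auto
    qed
    also have "?r \<bullet> y = - (b \<bullet> (W *\<^sub>v y))"
    proof -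
      have "?r \<bullet> y = - ((transpose_mat W *\<^sub>v b) \<bullet> y)"
        using y Wc bC by (intro scalar_prod_uminus_left) auto
      also have "(transpose_mat W *\<^sub>v b) \<bullet> y = b \<bullet> (W *\<^sub>v y)"
        using y Wc bC by (subst scalar_prod_mult_mat_vec[of _ n]) auto
      finally show ?thesis .
    qed
    also have "quad G' (vCons (t + - (b \<bullet> (W *\<^sub>v y))) (W *\<^sub>v y)) = t\<^sup>2 + y \<bullet> y"
      using quad_bordered[OF bC(1,2), of "W *\<^sub>v y" 1 "t + - (b \<bullet> (W *\<^sub>v y))"] y Wc Wq[OF y]
      by (simp add: G'_eq)
    also have "\<dots> = z \<bullet> z" by (simp add: zy power2_eq_square)
    finally show ?thesis .
  qed
  then show ?case using unimodular_mult[OF U(1) V] by blast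
qed

section \<open>Neighbours of the standard lattice\<close>

definition reps :: "nat \<Rightarrow> int \<Rightarrow> int vec set" where
  "reps n k = {x \<in> carrier_vec n. x \<bullet> x = k}"

lemma scalar_prod_self_nonneg: "0 \<le> (x :: int vec) \<bullet> x"
  unfolding scalar_prod_def by (intro sum_nonneg) simp

lemma finite_reps: "finite (reps n k)"
proof (induction n arbitrary: k)
  case 0
  have "reps 0 k \<subseteq> {vNil}" unfolding reps_def by auto
  then show ?case by (rule finite_subset) simp
next
  case (Suc n)
  have "reps (Suc n) k \<subseteq> (\<Union>a\<in>{- k..k}. vCons a ` reps n (k - a * a))"
  proof
    fix x assume x: "x \<in> reps (Suc n) k"
    then obtain a y where ay: "x = vCons a y" "y \<in> carrier_vec n"
      unfolding reps_def by (auto elim: carrier_vec_SucE)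
    have k: "a * a + y \<bullet> y = k" using x by (simp add: reps_def ay)
    have "\<bar>a\<bar> * 1 \<le> \<bar>a\<bar> * \<bar>a\<bar>" using mult_left_mono[of 1 "\<bar>a\<bar>" "\<bar>a\<bar>"] by (cases "a = 0") auto
    then have "\<bar>a\<bar> \<le> k" using k scalar_prod_self_nonneg[of y] by simp
    moreover have "y \<in> reps n (k - a * a)" using k ay by (simp add: reps_def)
    ultimately show "x \<in> (\<Union>a\<in>{- k..k}. vCons a ` reps n (k - a * a))"
      unfolding ay by (intro UN_I[of a] imageI) auto
  qed
  then show ?case by (rule finite_subset) (use Suc.IH in blast)
qed

lemma mult_mat_vec_eq_0:
  fixes K :: "int mat"
  assumes K: "K \<in> carrier_mat n n" and "det K \<noteq> 0" and x: "x \<in> carrier_vec n" and "K *\<^sub>v x = 0\<^sub>v n"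
  shows "x = 0\<^sub>v n"
proof -
  note A = adj_mat[OF K]
  have "(adj_mat K * K) *\<^sub>v x = adj_mat K *\<^sub>v 0\<^sub>v n"
    unfolding assoc_mult_mat_vec[OF A(1) K x] assms(4) ..
  also have "\<dots> = 0\<^sub>v n" using A by auto
  finally have 0: "(det K \<cdot>\<^sub>m 1\<^sub>m n) *\<^sub>v x = 0\<^sub>v n" using A by simp
  have "x $ i = 0" if i: "i < n" for i
  proof -
    have "row (det K \<cdot>\<^sub>m 1\<^sub>m n) i = det K \<cdot>\<^sub>v unit_vec n i" using i by (intro eq_vecI) auto
    then have "((det K \<cdot>\<^sub>m 1\<^sub>m n) *\<^sub>v x) $ i = det K * x $ i" using i x by simp
    then show ?thesis using 0 i assms(2) by simp
  qed
  then show ?thesis using x by (intro eq_vecI) auto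
qed

text \<open>Divided by \<open>p\<close>, the column lattice of \<open>K\<close> has the integral
  Gram matrix \<open>G\<close> of determinant 1, so in rank at most 5 it is isometric to the
  standard lattice. The bijection is \<open>K\<close> composed with an orthonormal basis of
  \<open>G\<close>.\<close>

lemma card_integral_sublattice:
  fixes K :: "int mat" and p :: int
  assumes K: "K \<in> carrier_mat n n" and p: "0 < p" and det: "\<bar>det K\<bar> = p ^ n" and n: "n \<le> 5"
    and dvd: "\<And>i j. i < n \<Longrightarrow> j < n \<Longrightarrow> p\<^sup>2 dvd col K i \<bullet> col K j"
  shows "card {y \<in> (\<lambda>z. K *\<^sub>v z) ` carrier_vec n. y \<bullet> y = p\<^sup>2 * k} = card (reps n k)"
proof -
  define G where "G = mat n n (\<lambda>(i, j). (col K i \<bullet> col K j) div p\<^sup>2)"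
  have G: "G \<in> carrier_mat n n" by (simp add: G_def)
  have KK: "transpose_mat K * K = p\<^sup>2 \<cdot>\<^sub>m G"
    using K dvd by (intro eq_matI) (auto simp: G_def)
  have det0: "det K \<noteq> 0" using det p by auto
  have inj: "K *\<^sub>v x \<noteq> 0\<^sub>v n" if "x \<in> carrier_vec n" "x \<noteq> 0\<^sub>v n" for x
    using mult_mat_vec_eq_0[OF K det0] that by blast
  have quadG: "p\<^sup>2 * quad G x = (K *\<^sub>v x) \<bullet> (K *\<^sub>v x)" if x: "x \<in> carrier_vec n" for x
  proof -
    have "(K *\<^sub>v x) \<bullet> (K *\<^sub>v x) = x \<bullet> ((transpose_mat K * K) *\<^sub>v x)"
      using K x by (simp add: scalar_prod_mult_mat_vec[of _ n] assoc_mult_mat_vec[of _ n n _ n])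
    also have "(transpose_mat K * K) *\<^sub>v x = p\<^sup>2 \<cdot>\<^sub>v (G *\<^sub>v x)"
      unfolding KK using G x by (intro eq_vecI) auto
    finally show ?thesis using G x by (simp add: quad_def)
  qed
  have self_pos: "0 < y \<bullet> y" if "y \<in> carrier_vec n" "y \<noteq> 0\<^sub>v n" for y :: "int vec"
  proof -
    have "\<exists>i<n. y $ i \<noteq> 0"
    proof (rule ccontr)
      assume "\<not> (\<exists>i<n. y $ i \<noteq> 0)"
      then have "y = 0\<^sub>v n" using that(1) by (intro eq_vecI) auto
      with that(2) show False ..
    qed
    then obtain i where i: "i < n" "y $ i \<noteq> 0" by blast
    have "0 < (\<Sum>i = 0..<dim_vec y. y $ i * y $ i)"
      using i that by (intro sum_pos2[of _ i]) (auto simp: zero_less_mult_iff linorder_neq_iff)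
    then show ?thesis by (simp add: scalar_prod_def)
  qed
  have "pos_def n G"
    unfolding pos_def_def
  proof (intro conjI ballI impI G)
    show "transpose_mat G = G"
      using K by (intro eq_matI) (auto simp: G_def intro!: arg_cong[of _ _ "\<lambda>x. x div p\<^sup>2"] comm_scalar_prod[of _ n])
    fix x :: "int vec" assume x: "x \<in> carrier_vec n" "x \<noteq> 0\<^sub>v n"
    have "0 < p\<^sup>2 * quad G x" unfolding quadG[OF x(1)] using K x inj by (intro self_pos) auto
    then show "0 < quad G x" using p by (simp add: zero_less_mult_iff)
  qed
  moreover have "det G = 1"
  proof -
    have "det (transpose_mat K * K) = (det K)\<^sup>2"
      using K by (simp add: det_mult[of _ n] det_transpose[of _ n] power2_eq_square)
    also have "\<dots> = \<bar>det K\<bar>\<^sup>2" by simp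
    also have "\<dots> = (p\<^sup>2) ^ n" unfolding det by (simp add: power_mult[symmetric] mult.commute)
    finally have "(p\<^sup>2) ^ n * det G = (p\<^sup>2) ^ n" unfolding KK using G by (simp add: det_smult)
    then show ?thesis using p by simp
  qed
  ultimately obtain U where U: "unimodular n U" and quadU: "\<And>x. x \<in> carrier_vec n \<Longrightarrow> quad G (U *\<^sub>v x) = x \<bullet> x"
    using unimodular_lattice_orthonormal_basis[of n G] n by blast
  obtain V where V: "unimodular n V" "U * V = 1\<^sub>m n" using unimodular_inverse[OF U] by metis
  have Uc: "U \<in> carrier_mat n n" and Vc: "V \<in> carrier_mat n n" using U V by (auto simp: unimodular_def)
  have norm: "(K *\<^sub>v (U *\<^sub>v x)) \<bullet> (K *\<^sub>v (U *\<^sub>v x)) = p\<^sup>2 * (x \<bullet> x)" if "x \<in> carrier_vec n" for x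
    using that Uc quadG[of "U *\<^sub>v x"] quadU[of x] by simp
  have "bij_betw (\<lambda>x. K *\<^sub>v (U *\<^sub>v x)) (reps n k) {y \<in> (\<lambda>z. K *\<^sub>v z) ` carrier_vec n. y \<bullet> y = p\<^sup>2 * k}"
    unfolding bij_betw_def
  proof
    show "inj_on (\<lambda>x. K *\<^sub>v (U *\<^sub>v x)) (reps n k)"
    proof (rule inj_onI)
      fix x x' assume "x \<in> reps n k" "x' \<in> reps n k" and eq: "K *\<^sub>v (U *\<^sub>v x) = K *\<^sub>v (U *\<^sub>v x')"
      then have x: "x \<in> carrier_vec n" "x' \<in> carrier_vec n" by (auto simp: reps_def)
      have "K *\<^sub>v (U *\<^sub>v (x - x')) = K *\<^sub>v (U *\<^sub>v x) - K *\<^sub>v (U *\<^sub>v x')"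
        using x K Uc by (simp add: mult_minus_distrib_mat_vec[of _ n n])
      also have "\<dots> = 0\<^sub>v n" using eq K by auto
      finally have "p\<^sup>2 * ((x - x') \<bullet> (x - x')) = 0" using norm[of "x - x'"] x by simp
      then have "\<not> 0 < (x - x') \<bullet> (x - x')" using p by simp
      then have *: "x - x' = 0\<^sub>v n" using self_pos[of "x - x'"] x by auto
      show "x = x'"
      proof (rule eq_vecI)
        fix i assume i: "i < dim_vec x'"
        then have "(x - x') $ i = x $ i - x' $ i" by simp
        moreover have "(x - x') $ i = 0" unfolding * using i x by simp
        ultimately show "x $ i = x' $ i" by simp
      qed (use x in auto)
    qed
    show "(\<lambda>x. K *\<^sub>v (U *\<^sub>v x)) ` reps n k = {y \<in> (\<lambda>z. K *\<^sub>v z) ` carrier_vec n. y \<bullet> y = p\<^sup>2 * k}"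
    proof (intro equalityI subsetI)
      fix y assume "y \<in> (\<lambda>x. K *\<^sub>v (U *\<^sub>v x)) ` reps n k"
      then obtain x where x: "x \<in> carrier_vec n" "x \<bullet> x = k" and y: "y = K *\<^sub>v (U *\<^sub>v x)"
        by (auto simp: reps_def)
      have "U *\<^sub>v x \<in> carrier_vec n" using Uc x by simp
      then show "y \<in> {y \<in> (\<lambda>z. K *\<^sub>v z) ` carrier_vec n. y \<bullet> y = p\<^sup>2 * k}"
        using norm[OF x(1)] x unfolding y by blast
    next
      fix y assume "y \<in> {y \<in> (\<lambda>z. K *\<^sub>v z) ` carrier_vec n. y \<bullet> y = p\<^sup>2 * k}"
      then obtain z where z: "z \<in> carrier_vec n" "y = K *\<^sub>v z" and yy: "y \<bullet> y = p\<^sup>2 * k" by blast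
      define x where "x = V *\<^sub>v z"
      have x: "x \<in> carrier_vec n" using Vc z by (simp add: x_def)
      have "U *\<^sub>v x = (U * V) *\<^sub>v z" using Uc Vc z by (simp add: x_def assoc_mult_mat_vec[of _ n n _ n])
      then have Ux: "U *\<^sub>v x = z" using V z by simp
      have "p\<^sup>2 * (x \<bullet> x) = p\<^sup>2 * k" using norm[OF x] yy by (simp add: Ux z)
      then have "x \<in> reps n k" using x p by (simp add: reps_def)
      then show "y \<in> (\<lambda>x. K *\<^sub>v (U *\<^sub>v x)) ` reps n k" using Ux z by (metis image_eqI)
    qed
  qed
  then show ?thesis by (simp add: bij_betw_same_card)
qed

text \<open>For \<open>v\<close> with \<open>p\<^sup>2\<close> dividing \<open>v \<bullet> v\<close> this is \<open>p\<close> times the \<open>p\<close>-neighbour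
  \<open>{x \<in> \<int>\<^sup>n. p dvd x \<bullet> v} + \<int> (v / p)\<close> of \<open>\<int>\<^sup>n\<close>.\<close>

definition neighbour :: "nat \<Rightarrow> int \<Rightarrow> int vec \<Rightarrow> int vec set" where
  "neighbour n p v = {y \<in> carrier_vec n. (\<exists>a. \<forall>i<n. p dvd y $ i - a * v $ i) \<and> p\<^sup>2 dvd y \<bullet> v}"

lemma neighbourE:
  assumes "y \<in> neighbour n p v" "v \<in> carrier_vec n"
  obtains a u where "u \<in> carrier_vec n" "y = a \<cdot>\<^sub>v v + p \<cdot>\<^sub>v u"
proof -
  obtain a where a: "\<forall>i<n. p dvd y $ i - a * v $ i" and y: "y \<in> carrier_vec n"
    using assms by (auto simp: neighbour_def)
  show thesis
  proof
    show "vec n (\<lambda>i. (y $ i - a * v $ i) div p) \<in> carrier_vec n" by simp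
    show "y = a \<cdot>\<^sub>v v + p \<cdot>\<^sub>v vec n (\<lambda>i. (y $ i - a * v $ i) div p)"
      using y a assms(2) by (intro eq_vecI) auto
  qed
qed

text \<open>This is the integrality of the neighbour. Writing y' = a' v + p u', the condition on y'
  makes p (u' . v) divisible by p^2, which controls all mixed terms.\<close>

lemma neighbour_dot:
  assumes y: "y \<in> neighbour n p v" and y': "y' \<in> neighbour n p v"
    and v: "v \<in> carrier_vec n" "p\<^sup>2 dvd v \<bullet> v"
  shows "p\<^sup>2 dvd y \<bullet> y'"
proof -
  obtain a u where u: "u \<in> carrier_vec n" "y = a \<cdot>\<^sub>v v + p \<cdot>\<^sub>v u" using neighbourE[OF y v(1)] .
  obtain a' u' where u': "u' \<in> carrier_vec n" "y' = a' \<cdot>\<^sub>v v + p \<cdot>\<^sub>v u'" using neighbourE[OF y' v(1)] .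
  have yv: "p\<^sup>2 dvd y \<bullet> v" "p\<^sup>2 dvd y' \<bullet> v" "y \<in> carrier_vec n"
    using y y' by (auto simp: neighbour_def)
  have "y' \<bullet> v = a' * (v \<bullet> v) + p * (u' \<bullet> v)"
    using u' v by (simp add: add_scalar_prod_distrib[of _ n])
  then have *: "p\<^sup>2 dvd p * (u' \<bullet> v)" using yv(2) v(2) by (simp add: dvd_add_right_iff)
  have "y \<bullet> y' = a' * (y \<bullet> v) + p * (y \<bullet> u')"
    using u' v yv by (simp add: scalar_prod_add_distrib[of _ n])
  also have "y \<bullet> u' = a * (v \<bullet> u') + p * (u \<bullet> u')"
    using u u' v by (simp add: add_scalar_prod_distrib[of _ n])
  also have "v \<bullet> u' = u' \<bullet> v" using u' v by (intro comm_scalar_prod[of _ n])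
  finally have "y \<bullet> y' = a' * (y \<bullet> v) + a * (p * (u' \<bullet> v)) + p\<^sup>2 * (u \<bullet> u')"
    by (simp add: algebra_simps power2_eq_square)
  then show ?thesis using yv * by simp
qed

lemma inverse_mod_prime_square:
  fixes p c :: int
  assumes "prime p" "\<not> p dvd c" obtains b where "p\<^sup>2 dvd c * b - 1"
proof -
  have "coprime c (p\<^sup>2)" using assms by (metis coprime_commute coprime_power_right_iff prime_imp_coprime)
  then obtain b where "[c * b = 1] (mod p\<^sup>2)" using cong_solve_coprime_int by blast
  then show thesis using that by (simp add: cong_iff_dvd_diff)
qed

lemma prime_square_dvd_mult:
  fixes p c t :: int
  assumes "prime p" "\<not> p dvd c" "p\<^sup>2 dvd t * c" shows "p\<^sup>2 dvd t"
proof -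
  have "coprime (p\<^sup>2) c" using assms by (metis coprime_commute coprime_power_right_iff prime_imp_coprime)
  then show ?thesis using assms(3) by (simp add: coprime_dvd_mult_left_iff)
qed

text \<open>A first coordinate 1 and a last coordinate invertible modulo \<open>p\<close> allow an
  explicit triangular basis of the scaled neighbour, so its determinant p^n can be read off the
  diagonal.\<close>

lemma card_neighbour_normalized:
  fixes p k :: int
  assumes p: "prime p" and n: "2 \<le> n" "n \<le> 5" and v: "v \<in> carrier_vec n" "p\<^sup>2 dvd v \<bullet> v"
    and v0: "v $ 0 = 1" and c: "\<not> p dvd v $ (n - 1)"
  shows "card {y \<in> neighbour n p v. y \<bullet> y = p\<^sup>2 * k} = card (reps n k)"
proof -
  define l where "l = n - 1"
  have l: "0 < l" "l < n" "n = Suc l" using n by (auto simp: l_def)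
  define c where "c = v $ l"
  have pc: "\<not> p dvd c" using c by (simp add: c_def l_def)
  obtain b where b: "p\<^sup>2 dvd c * b - 1" using inverse_mod_prime_square[OF p pc] .
  \<comment> \<open>Column 0 is \<open>v\<close>, the last column is p^2 e_l, and a middle column is
    p (e_j - b v_j e_l). As \<open>b\<close> inverts \<open>c\<close> modulo p^2, the latter has
    scalar product with \<open>v\<close> divisible by p^2. The diagonal is 1, p, ..., p,
    p^2.\<close>
  define K where "K = mat n n (\<lambda>(i, j). if j = 0 then v $ i
    else if i = l then (if j = l then p\<^sup>2 else - p * b * v $ j) else if i = j then p else 0)"
  have K: "K \<in> carrier_mat n n" by (simp add: K_def)
  have "det K = prod_list (diag_mat K)"
    using K by (intro det_lower_triangular[of n]) (auto simp: K_def l)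
  also have "\<dots> = (\<Prod>i\<in>{0..<n}. K $$ (i, i))" using K by (simp add: prod_list_diag_prod)
  also have "\<dots> = K $$ (0, 0) * (\<Prod>i\<in>{1..<l}. K $$ (i, i)) * K $$ (l, l)"
    using l by (simp add: prod.atLeast0_lessThan_Suc prod.atLeast_Suc_lessThan)
  also have "(\<Prod>i\<in>{1..<l}. K $$ (i, i)) = (\<Prod>i\<in>{1..<l}. p)"
    using l by (intro prod.cong) (auto simp: K_def)
  also have "K $$ (0, 0) * (\<Prod>i\<in>{1..<l}. p) * K $$ (l, l) = p ^ (l - 1 + 2)"
  proof -
    have "K $$ (0, 0) = 1" "K $$ (l, l) = p\<^sup>2" using l v0 by (simp_all add: K_def)
    then show ?thesis by (simp only: power_add prod_constant card_atLeastLessThan mult_1)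
  qed
  finally have det: "\<bar>det K\<bar> = p ^ n"
    using l prime_gt_0_int[OF p] by simp
  \<comment> \<open>The columns of \<open>K\<close> form a basis of the neighbour lattice.\<close>
  have col0: "col K 0 = v" using v l by (intro eq_vecI) (auto simp: K_def)
  have colm: "col K j = p \<cdot>\<^sub>v unit_vec n j + (- p * b * v $ j) \<cdot>\<^sub>v unit_vec n l" if "0 < j" "j < l" for j
    using that l by (intro eq_vecI) (auto simp: K_def)
  have coll: "col K l = p\<^sup>2 \<cdot>\<^sub>v unit_vec n l" using l by (intro eq_vecI) (auto simp: K_def)
  have colv: "p\<^sup>2 dvd col K j \<bullet> v" if "j < n" for j
  proof -
    consider "j = 0" | "0 < j" "j < l" | "j = l" using \<open>j < n\<close> l by linarith
    then show ?thesis
    proof cases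
      case 1 then show ?thesis using v by (simp add: col0)
    next
      case 2
      have "col K j \<bullet> v = - (p * v $ j * (c * b - 1))"
        unfolding colm[OF 2] using v 2 l
        by (simp add: add_scalar_prod_distrib[of _ n] c_def algebra_simps)
      then show ?thesis using b by simp
    next
      case 3 then show ?thesis using v l by (simp add: coll)
    qed
  qed
  have Kv: "p\<^sup>2 dvd (K *\<^sub>v z) \<bullet> v" if z: "z \<in> carrier_vec n" for z
  proof -
    have "(K *\<^sub>v z) \<bullet> v = z \<bullet> (transpose_mat K *\<^sub>v v)" using K z v by (intro scalar_prod_mult_mat_vec)
    also have "p\<^sup>2 dvd \<dots>"
      unfolding scalar_prod_def using K colv by (intro dvd_sum dvd_mult) auto
    finally show ?thesis .
  qed
  have rowK: "(K *\<^sub>v z) $ i = z $ 0 * v $ i + (if i = 0 then 0 else p * z $ i)" if z: "z \<in> carrier_vec n" and i: "i < l" for z i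
  proof -
    have "row K i = v $ i \<cdot>\<^sub>v unit_vec n 0 + (if i = 0 then 0 else p) \<cdot>\<^sub>v unit_vec n i"
      using i l by (intro eq_vecI) (auto simp: K_def)
    then show ?thesis using z i l K by (simp add: add_scalar_prod_distrib[of _ n])
  qed
  have rowl: "p dvd (K *\<^sub>v z) $ l - z $ 0 * v $ l" if z: "z \<in> carrier_vec n" for z
  proof -
    have "(K *\<^sub>v z) $ l = (\<Sum>j\<in>{0..<n}. K $$ (l, j) * z $ j)" using z l K by (simp add: scalar_prod_def)
    also have "\<dots> = v $ l * z $ 0 + (\<Sum>j\<in>{1..<n}. K $$ (l, j) * z $ j)"
      using l by (simp add: sum.atLeast_Suc_lessThan K_def)
    finally have "(K *\<^sub>v z) $ l - z $ 0 * v $ l = (\<Sum>j\<in>{1..<n}. K $$ (l, j) * z $ j)" by simp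
    also have "p dvd \<dots>" using l by (intro dvd_sum dvd_mult2) (auto simp: K_def power2_eq_square)
    finally show ?thesis .
  qed
  have sub: "K *\<^sub>v z \<in> neighbour n p v" if z: "z \<in> carrier_vec n" for z
  proof -
    have "p dvd (K *\<^sub>v z) $ i - z $ 0 * v $ i" if "i < n" for i
      using rowK[OF z, of i] rowl[OF z] that l by (cases "i = l") auto
    then show ?thesis using K z Kv[OF z] unfolding neighbour_def by auto
  qed
  have "neighbour n p v = (\<lambda>z. K *\<^sub>v z) ` carrier_vec n"
  proof (intro equalityI subsetI)
    fix y assume y: "y \<in> neighbour n p v"
    then have yc: "y \<in> carrier_vec n" and yv: "p\<^sup>2 dvd y \<bullet> v" by (auto simp: neighbour_def)
    obtain a where a: "\<forall>i<n. p dvd y $ i - a * v $ i" using y by (auto simp: neighbour_def)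
    have y0: "p dvd y $ i - y $ 0 * v $ i" if "i < n" for i
    proof -
      have "p dvd y $ 0 - a" using a l v0 by fastforce
      then have "p dvd (y $ i - a * v $ i) - (y $ 0 - a) * v $ i"
        by (intro dvd_diff[OF a[rule_format, OF that] dvd_mult2])
      then show ?thesis by (simp add: algebra_simps)
    qed
    \<comment> \<open>Back substitution matches all coordinates but the last. The error
      \<open>t\<close> there is divisible by p^2 because both vectors have scalar product with
      \<open>v\<close> divisible by p^2, so the last column removes it.\<close>
    define z where "z = vec n (\<lambda>i. if i = 0 then y $ 0 else if i = l then 0 else (y $ i - y $ 0 * v $ i) div p)"
    have z: "z \<in> carrier_vec n" by (simp add: z_def)
    have Kz: "(K *\<^sub>v z) $ i = y $ i" if "i < l" for i
      using rowK[OF z that] y0[of i] that l v0 by (auto simp: z_def)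
    define t where "t = y $ l - (K *\<^sub>v z) $ l"
    have yt: "y = K *\<^sub>v z + t \<cdot>\<^sub>v unit_vec n l"
    proof (rule eq_vecI)
      fix i assume "i < dim_vec (K *\<^sub>v z + t \<cdot>\<^sub>v unit_vec n l)"
      then have "i < n" by simp
      then show "y $ i = (K *\<^sub>v z + t \<cdot>\<^sub>v unit_vec n l) $ i"
        using Kz[of i] l K by (cases "i = l") (auto simp: t_def simp del: index_mult_mat_vec)
    qed (use yc in simp)
    have "y \<bullet> v = (K *\<^sub>v z) \<bullet> v + t * c"
      unfolding yt c_def using K z v l by (simp add: add_scalar_prod_distrib[of _ n])
    then have "p\<^sup>2 dvd t * c" using yv Kv[OF z] by (metis dvd_add_right_iff)
    then have "p\<^sup>2 dvd t" using prime_square_dvd_mult[OF p pc] by blast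
    then obtain s where s: "t = p\<^sup>2 * s" ..
    have "K *\<^sub>v (z + s \<cdot>\<^sub>v unit_vec n l) = K *\<^sub>v z + s \<cdot>\<^sub>v (K *\<^sub>v unit_vec n l)"
    proof -
      have "K *\<^sub>v (s \<cdot>\<^sub>v unit_vec n l) = s \<cdot>\<^sub>v (K *\<^sub>v unit_vec n l)" using K by (intro eq_vecI) auto
      then show ?thesis using K z by (simp add: mult_add_distrib_mat_vec[of _ n n])
    qed
    also have "K *\<^sub>v unit_vec n l = col K l" using K l by (intro eq_vecI) auto
    also have "K *\<^sub>v z + s \<cdot>\<^sub>v col K l = y" unfolding coll yt s by (simp add: smult_smult_assoc mult.commute)
    finally show "y \<in> (\<lambda>z. K *\<^sub>v z) ` carrier_vec n" using z by (intro image_eqI[of _ _ "z + s \<cdot>\<^sub>v unit_vec n l"]) auto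
  qed (use sub in auto)
  moreover have "card {y \<in> (\<lambda>z. K *\<^sub>v z) ` carrier_vec n. y \<bullet> y = p\<^sup>2 * k} = card (reps n k)"
  proof (rule card_integral_sublattice[OF K _ det n(2)])
    fix i j assume "i < n" "j < n"
    have "col K j \<in> neighbour n p v" if "j < n" for j
    proof -
      have "K *\<^sub>v unit_vec n j = col K j" using K that by (intro eq_vecI) auto
      then show ?thesis using sub[of "unit_vec n j"] by simp
    qed
    then show "p\<^sup>2 dvd col K i \<bullet> col K j" using neighbour_dot v \<open>i < n\<close> \<open>j < n\<close> by blast
  qed (use prime_gt_0_int[OF p] in simp)
  ultimately show ?thesis by simp
qed

lemma dvd_scalar_prod_diff:
  fixes u u' w :: "int vec"
  assumes "u \<in> carrier_vec n" "u' \<in> carrier_vec n" "w \<in> carrier_vec n" "\<forall>i<n. m dvd u $ i - u' $ i"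
  shows "m dvd w \<bullet> u - w \<bullet> u'"
proof -
  have "w \<bullet> u - w \<bullet> u' = (\<Sum>i = 0..<n. w $ i * (u $ i - u' $ i))"
    using assms by (simp add: scalar_prod_def sum_subtractf right_diff_distrib)
  also have "m dvd \<dots>" using assms by (intro dvd_sum) auto
  finally show ?thesis .
qed

lemma dvd_scalar_prod_self_diff:
  fixes u u' :: "int vec"
  assumes "u \<in> carrier_vec n" "u' \<in> carrier_vec n" "\<forall>i<n. m dvd u $ i - u' $ i"
  shows "m dvd u \<bullet> u - u' \<bullet> u'"
proof -
  have "m dvd (u \<bullet> u - u \<bullet> u') + (u' \<bullet> u - u' \<bullet> u')"
    using assms by (intro dvd_add dvd_scalar_prod_diff[of _ n])
  moreover have "u \<bullet> u' = u' \<bullet> u" using assms by (intro comm_scalar_prod[of _ n])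
  ultimately show ?thesis by simp
qed

lemma dvd_mod_minus_self: "(m :: int) dvd a mod m - a"
  by (metis dvd_minus_iff dvd_minus_mod minus_diff_eq)

text \<open>Up to a permutation of coordinates the neighbour depends on \<open>v\<close> only modulo
  p^2 and up to units, so \<open>v\<close> can be brought into the normalized shape.\<close>

lemma card_neighbour:
  fixes p k :: int
  assumes p: "prime p" and n: "n \<le> 5" and v: "v \<in> carrier_vec n" "p\<^sup>2 dvd v \<bullet> v"
    and nz: "\<exists>i<n. \<not> p dvd v $ i"
  shows "card {y \<in> neighbour n p v. y \<bullet> y = p\<^sup>2 * k} = card (reps n k)"
proof -
  obtain i where i: "i < n" "\<not> p dvd v $ i" using nz by blast
  \<comment> \<open>If \<open>v $ i\<close> were the only coordinate nonzero modulo
    \<open>p\<close>, then \<open>v \<bullet> v\<close> would be congruent to its square and not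
    divisible by \<open>p\<close>.\<close>
  obtain j where j: "j < n" "j \<noteq> i" "\<not> p dvd v $ j"
  proof (rule ccontr)
    assume *: "\<not> thesis"
    have "p dvd v $ j * v $ j" if "j \<in> {0..<n} - {i}" for j
    proof -
      have "p dvd v $ j" using that * \<open>\<And>j. j < n \<Longrightarrow> j \<noteq> i \<Longrightarrow> \<not> p dvd v $ j \<Longrightarrow> thesis\<close> by auto
      then show ?thesis by simp
    qed
    then have "p dvd (\<Sum>j \<in> {0..<n} - {i}. v $ j * v $ j)" by (rule dvd_sum)
    moreover have "v \<bullet> v = v $ i * v $ i + (\<Sum>j \<in> {0..<n} - {i}. v $ j * v $ j)"
      using v i by (simp add: scalar_prod_def sum.remove[of _ i])
    moreover have "p dvd v \<bullet> v" using v(2) by (meson dvd_power dvd_trans pos2)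
    ultimately have "p dvd v $ i * v $ i" by (simp add: dvd_add_left_iff)
    then show False using i p by (simp add: prime_dvd_mult_iff)
  qed
  have n2: "2 \<le> n" using i j by linarith
  define \<pi>1 where "\<pi>1 = transpose 0 i"
  \<comment> \<open>The first swap may move \<open>j\<close>, so the second one must start from its
    new position \<open>\<pi>1 j\<close>.\<close>
  define \<pi>2 where "\<pi>2 = transpose (n - 1) (\<pi>1 j)"
  define \<pi> where "\<pi> = \<pi>1 \<circ> \<pi>2"
  have "\<pi>1 permutes {0..<n}" using i by (auto simp: \<pi>1_def intro!: permutes_swap_id)
  moreover have \<pi>1j: "\<pi>1 j < n" using calculation j permutes_in_image[of \<pi>1 "{0..<n}" j] by simp
  moreover have "\<pi>2 permutes {0..<n}" unfolding \<pi>2_def using \<pi>1j n2 by (intro permutes_swap_id) auto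
  ultimately have \<pi>: "\<pi> permutes {0..<n}" unfolding \<pi>_def by (intro permutes_compose)
  have "\<pi>1 j \<noteq> 0" using j by (auto simp: \<pi>1_def transpose_def split: if_splits)
  then have \<pi>0: "\<pi> 0 = i" using n2 by (auto simp: \<pi>_def \<pi>2_def transpose_def \<pi>1_def split: if_splits)
  have \<pi>l: "\<pi> (n - 1) = j" by (simp add: \<pi>_def \<pi>2_def \<pi>1_def)
  have \<pi>n: "\<pi> k < n" if "k < n" for k using permutes_in_image[OF \<pi>, of k] that by simp
  define \<sigma> where "\<sigma> = inv_into UNIV \<pi>"
  have \<sigma>: "\<pi> (\<sigma> k) = k" "\<sigma> (\<pi> k) = k" for k using permutes_inverses[OF \<pi>] by (auto simp: \<sigma>_def)
  have \<sigma>n: "\<sigma> k < n" if "k < n" for k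
    using permutes_in_image[OF permutes_inv[OF \<pi>], of k] that by (simp add: \<sigma>_def)
  define P where "P y = vec n (\<lambda>k. y $ \<pi> k)" for y :: "int vec"
  have Pc: "P y \<in> carrier_vec n" for y by (simp add: P_def)
  have Pdot: "P y \<bullet> P w = y \<bullet> w" if "y \<in> carrier_vec n" "w \<in> carrier_vec n" for y w
  proof -
    have "P y \<bullet> P w = (\<Sum>k = 0..<n. y $ \<pi> k * w $ \<pi> k)" by (simp add: P_def scalar_prod_def)
    also have "\<dots> = (\<Sum>k = 0..<n. y $ k * w $ k)"
      using sum.permute[OF \<pi>, of "\<lambda>k. y $ k * w $ k"] by (simp add: o_def)
    finally show ?thesis using that by (simp add: scalar_prod_def)
  qed
  obtain b where b: "p\<^sup>2 dvd v $ i * b - 1" using inverse_mod_prime_square[OF p i(2)] .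
  have pb1: "p dvd v $ i * b - 1" using b by (meson dvd_power dvd_trans pos2)
  have pb: "\<not> p dvd b"
  proof
    assume "p dvd b"
    then have "p dvd v $ i * b - (v $ i * b - 1)" by (intro dvd_diff[OF dvd_mult pb1])
    then show False using p by (simp add: not_prime_unit)
  qed
  define w where "w = b \<cdot>\<^sub>v P v"
  \<comment> \<open>The first coordinate of \<open>w\<close> is 1 only modulo p^2; reducing makes it
    equal to 1.\<close>
  define v' where "v' = vec n (\<lambda>k. w $ k mod p\<^sup>2)"
  have wc: "w \<in> carrier_vec n" and v'c: "v' \<in> carrier_vec n" by (auto simp: w_def v'_def P_def)
  have wk: "w $ k = b * v $ \<pi> k" if "k < n" for k using that by (simp add: w_def P_def)
  have v'w: "\<forall>k<n. p\<^sup>2 dvd v' $ k - w $ k" by (simp add: v'_def dvd_mod_minus_self)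
  then have v'wp: "p dvd v' $ k - w $ k" if "k < n" for k using that by (meson dvd_power dvd_trans pos2)
  have "1 < p\<^sup>2" using prime_gt_1_int[OF p] by (simp add: one_less_power)
  then have "v' $ 0 = 1"
    using b n2 mod_eq_dvd_iff[of "v $ i * b" "p\<^sup>2" 1] by (simp add: v'_def wk \<pi>0 mult.commute)
  moreover have "\<not> p dvd v' $ (n - 1)"
  proof
    assume "p dvd v' $ (n - 1)"
    then have "p dvd v' $ (n - 1) - (v' $ (n - 1) - w $ (n - 1))"
      using n2 by (intro dvd_diff[OF _ v'wp]) simp_all
    then have "p dvd b * v $ j" using n2 wk[of "n - 1"] unfolding \<pi>l by simp
    then show False using p pb j by (simp add: prime_dvd_mult_iff)
  qed
  moreover have "p\<^sup>2 dvd v' \<bullet> v'"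
  proof -
    have "w \<bullet> w = b * b * (v \<bullet> v)" using Pdot[OF v(1) v(1)] Pc by (simp add: w_def)
    then have "p\<^sup>2 dvd w \<bullet> w" using v by simp
    moreover have "p\<^sup>2 dvd v' \<bullet> v' - w \<bullet> w" using dvd_scalar_prod_self_diff[OF v'c wc v'w] .
    ultimately show ?thesis using dvd_add[of "p\<^sup>2" "v' \<bullet> v' - w \<bullet> w" "w \<bullet> w"] by simp
  qed
  ultimately have card': "card {y \<in> neighbour n p v'. y \<bullet> y = p\<^sup>2 * k} = card (reps n k)"
    using card_neighbour_normalized[OF p n2 n v'c] by blast
  have iff: "P y \<in> neighbour n p v' \<longleftrightarrow> y \<in> neighbour n p v" if y: "y \<in> carrier_vec n" for y
  proof -
    have "P y \<bullet> w = b * (y \<bullet> v)" 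
      unfolding w_def scalar_prod_smult_distrib[OF Pc Pc] by (simp add: Pdot[OF y v(1)])
    then have "p\<^sup>2 dvd P y \<bullet> v' - (y \<bullet> v) * b"
      using dvd_scalar_prod_diff[OF v'c wc Pc v'w, of y] by (simp add: mult.commute)
    then have 1: "p\<^sup>2 dvd P y \<bullet> v' \<longleftrightarrow> p\<^sup>2 dvd y \<bullet> v"
      using prime_square_dvd_mult[OF p pb, of "y \<bullet> v"]
      by (metis dvd_diff_commute dvd_diff_left_iff dvd_mult2)
    have 2: "(\<exists>a. \<forall>k<n. p dvd P y $ k - a * v' $ k) \<longleftrightarrow> (\<exists>a. \<forall>k<n. p dvd y $ k - a * v $ k)"
    proof
      assume "\<exists>a. \<forall>k<n. p dvd P y $ k - a * v' $ k"
      then obtain a where a: "\<And>k. k < n \<Longrightarrow> p dvd P y $ k - a * v' $ k" by blast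
      have "p dvd y $ k - a * b * v $ k" if k: "k < n" for k
      proof -
        have "p dvd (P y $ \<sigma> k - a * v' $ \<sigma> k) + a * (v' $ \<sigma> k - w $ \<sigma> k)"
          using a[OF \<sigma>n[OF k]] v'wp[OF \<sigma>n[OF k]] by simp
        then show ?thesis using k \<sigma>n[OF k] by (simp add: P_def wk \<sigma> algebra_simps)
      qed
      then show "\<exists>a. \<forall>k<n. p dvd y $ k - a * v $ k" by blast
    next
      assume "\<exists>a. \<forall>k<n. p dvd y $ k - a * v $ k"
      then obtain a where a: "\<And>k. k < n \<Longrightarrow> p dvd y $ k - a * v $ k" by blast
      have "p dvd P y $ k - a * v $ i * v' $ k" if k: "k < n" for k
      proof -
        have "p dvd (y $ \<pi> k - a * v $ \<pi> k) - a * v $ \<pi> k * (v $ i * b - 1) - a * v $ i * (v' $ k - w $ k)"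
          by (intro dvd_diff dvd_mult a \<pi>n k pb1 v'wp)
        then show ?thesis using k by (simp add: P_def wk algebra_simps)
      qed
      then show "\<exists>a. \<forall>k<n. p dvd P y $ k - a * v' $ k" by blast
    qed
    show ?thesis unfolding neighbour_def using 1 2 y Pc by blast
  qed
  define Q where "Q y = vec n (\<lambda>k. y $ \<sigma> k)" for y :: "int vec"
  have QP: "Q (P y) = y" if "y \<in> carrier_vec n" for y
    using that by (intro eq_vecI) (auto simp: P_def Q_def \<sigma> \<sigma>n)
  have PQ: "P (Q y) = y" if "y \<in> carrier_vec n" for y
    using that by (intro eq_vecI) (auto simp: P_def Q_def \<sigma> \<pi>n)
  have Qc: "Q y \<in> carrier_vec n" for y by (simp add: Q_def)
  have nc: "y \<in> carrier_vec n" if "y \<in> neighbour n p u" for y u using that by (simp add: neighbour_def)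
  have "bij_betw P {y \<in> neighbour n p v. y \<bullet> y = p\<^sup>2 * k} {y \<in> neighbour n p v'. y \<bullet> y = p\<^sup>2 * k}"
  proof (rule bij_betw_byWitness[where f' = Q])
    show "\<forall>y\<in>{y \<in> neighbour n p v. y \<bullet> y = p\<^sup>2 * k}. Q (P y) = y" using QP nc by blast
    show "\<forall>y\<in>{y \<in> neighbour n p v'. y \<bullet> y = p\<^sup>2 * k}. P (Q y) = y" using PQ nc by blast
    show "P ` {y \<in> neighbour n p v. y \<bullet> y = p\<^sup>2 * k} \<subseteq> {y \<in> neighbour n p v'. y \<bullet> y = p\<^sup>2 * k}"
    proof (intro subsetI CollectI)
      fix z assume "z \<in> P ` {y \<in> neighbour n p v. y \<bullet> y = p\<^sup>2 * k}"
      then obtain y where y: "y \<in> neighbour n p v" "y \<bullet> y = p\<^sup>2 * k" and z: "z = P y" by blast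
      show "z \<in> neighbour n p v' \<and> z \<bullet> z = p\<^sup>2 * k"
        using y nc[OF y(1)] iff[of y] Pdot[of y y] unfolding z by simp
    qed
    show "Q ` {y \<in> neighbour n p v'. y \<bullet> y = p\<^sup>2 * k} \<subseteq> {y \<in> neighbour n p v. y \<bullet> y = p\<^sup>2 * k}"
    proof (intro subsetI CollectI)
      fix z assume "z \<in> Q ` {y \<in> neighbour n p v'. y \<bullet> y = p\<^sup>2 * k}"
      then obtain y where y: "y \<in> neighbour n p v'" "y \<bullet> y = p\<^sup>2 * k" and z: "z = Q y" by blast
      show "z \<in> neighbour n p v \<and> z \<bullet> z = p\<^sup>2 * k"
        using y PQ[OF nc[OF y(1)]] iff[OF Qc[of y]] Pdot[OF Qc[of y] Qc[of y]] unfolding z by simp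
    qed
  qed
  then show ?thesis using card' by (simp add: bij_betw_same_card)
qed

section \<open>Counting isotropic vectors modulo p\<close>

definition residue_vecs :: "nat \<Rightarrow> int \<Rightarrow> int vec set" where
  "residue_vecs n p = {v \<in> carrier_vec n. \<forall>i<n. v $ i \<in> {0..<p}}"

lemma residue_vecs_Suc:
  "residue_vecs (Suc n) p = (\<lambda>(a, v). vCons a v) ` ({0..<p} \<times> residue_vecs n p)"
proof (intro equalityI subsetI)
  fix x assume x: "x \<in> residue_vecs (Suc n) p"
  then have "x \<in> carrier_vec (Suc n)" by (simp add: residue_vecs_def)
  then obtain a v where av: "x = vCons a v" "v \<in> carrier_vec n" by (rule carrier_vec_SucE)
  have *: "x $ i \<in> {0..<p}" if "i < Suc n" for i using x that unfolding residue_vecs_def by blast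
  have "a \<in> {0..<p}" using *[of 0] by (simp add: av)
  moreover have "v $ i \<in> {0..<p}" if "i < n" for i using *[of "Suc i"] that av by simp
  then have "v \<in> residue_vecs n p" using av by (simp add: residue_vecs_def)
  ultimately show "x \<in> (\<lambda>(a, v). vCons a v) ` ({0..<p} \<times> residue_vecs n p)"
    by (intro image_eqI[of _ _ "(a, v)"]) (auto simp: av)
next
  fix x assume "x \<in> (\<lambda>(a, v). vCons a v) ` ({0..<p} \<times> residue_vecs n p)"
  then obtain a v where av: "x = vCons a v" "a \<in> {0..<p}" "v \<in> residue_vecs n p" by auto
  have "x $ i \<in> {0..<p}" if "i < Suc n" for i
    using that av by (cases i) (auto simp: residue_vecs_def)
  then show "x \<in> residue_vecs (Suc n) p" using av by (simp add: residue_vecs_def)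
qed

lemma card_residue_vecs: "finite (residue_vecs n p) \<and> card (residue_vecs n p) = nat p ^ n"
proof (induction n)
  case 0
  have "residue_vecs 0 p = {vNil}" by (auto simp: residue_vecs_def)
  then show ?case by simp
next
  case (Suc n)
  have "inj_on (\<lambda>(a, v). vCons a v) ({0..<p} \<times> residue_vecs n p)" by (auto simp: inj_on_def)
  then show ?case using Suc.IH by (simp add: residue_vecs_Suc card_image card_cartesian_product)
qed

lemma residue_vecs_eqI:
  assumes "u \<in> residue_vecs n p" "v \<in> residue_vecs n p" "\<And>i. i < n \<Longrightarrow> p dvd u $ i - v $ i"
  shows "u = v"
proof (rule eq_vecI)
  show "dim_vec u = dim_vec v" using assms(1,2) by (auto simp: residue_vecs_def)
  fix i assume "i < dim_vec v"
  then have i: "i < n" using assms(1,2) by (auto simp: residue_vecs_def)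
  have "u $ i mod p = v $ i mod p" using assms(3)[OF i] by (simp add: mod_eq_dvd_iff)
  then show "u $ i = v $ i" using assms(1,2) i by (simp add: residue_vecs_def)
qed

definition reduce :: "nat \<Rightarrow> int \<Rightarrow> (nat \<Rightarrow> int) \<Rightarrow> int vec" where
  "reduce n p f = vec n (\<lambda>i. f i mod p)"

lemma reduce_residue_vecs: "0 < p \<Longrightarrow> reduce n p f \<in> residue_vecs n p"
  by (simp add: reduce_def residue_vecs_def)

lemma reduce_dvd: "i < n \<Longrightarrow> p dvd reduce n p f $ i - f i"
  by (simp add: reduce_def dvd_mod_minus_self)

lemma inverse_mod_prime:
  fixes p c :: int
  assumes "prime p" "\<not> p dvd c" obtains b where "p dvd c * b - 1"
proof -
  obtain b where "p\<^sup>2 dvd c * b - 1" using inverse_mod_prime_square[OF assms] .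
  then have "p dvd c * b - 1" by (meson dvd_power dvd_trans pos2)
  then show thesis by (rule that)
qed

text \<open>Along each line \<open>v + t d\<close> the function \<open>g\<close> is affine with invertible slope \<open>e v\<close>, so it vanishes exactly
  once modulo \<open>p\<close>.\<close>

lemma card_residue_vecs_shift:
  fixes p :: int
  assumes p: "prime p"
    and inv: "\<And>u v t. u \<in> carrier_vec n \<Longrightarrow> v \<in> carrier_vec n \<Longrightarrow> P v \<Longrightarrow>
      (\<And>i. i < n \<Longrightarrow> p dvd u $ i - (v $ i + t * d $ i)) \<Longrightarrow>
      P u \<and> p dvd g u - (g v + t * e v)"
    and unit: "\<And>v. v \<in> carrier_vec n \<Longrightarrow> P v \<Longrightarrow> \<not> p dvd e v"
  shows "card {v \<in> residue_vecs n p. P v} = nat p * card {v \<in> residue_vecs n p. P v \<and> p dvd g v}"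
proof -
  let ?A = "{v \<in> residue_vecs n p. P v \<and> p dvd g v}" and ?B = "{v \<in> residue_vecs n p. P v}"
  define f where "f = (\<lambda>(v, t). reduce n p (\<lambda>i. v $ i + t * d $ i))"
  have p0: "0 < p" using prime_gt_0_int[OF p] .
  have rc: "v \<in> carrier_vec n" if "v \<in> residue_vecs n p" for v using that by (simp add: residue_vecs_def)
  have fr: "f (v, t) \<in> residue_vecs n p" for v t using p0 by (simp add: f_def reduce_residue_vecs)
  have fd: "p dvd f (v, t) $ i - (v $ i + t * d $ i)" if "i < n" for v t i
    unfolding f_def prod.case using reduce_dvd[OF that, of p "\<lambda>i. v $ i + t * d $ i"] .
  have "bij_betw f (?A \<times> {0..<p}) ?B"
    unfolding bij_betw_def
  proof
    show "inj_on f (?A \<times> {0..<p})"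
    proof (rule inj_onI)
      fix x x' assume x: "x \<in> ?A \<times> {0..<p}" "x' \<in> ?A \<times> {0..<p}" and eq: "f x = f x'"
      obtain v t v' t' where vt: "x = (v, t)" "x' = (v', t')" by (cases x, cases x')
      have v: "v \<in> residue_vecs n p" "P v" "p dvd g v" "0 \<le> t" "t < p"
        and v': "v' \<in> residue_vecs n p" "P v'" "p dvd g v'" "0 \<le> t'" "t' < p"
        using x by (auto simp: vt)
      have diff: "p dvd v' $ i - (v $ i + (t - t') * d $ i)" if "i < n" for i
      proof -
        have "p dvd (f (v, t) $ i - (v $ i + t * d $ i)) - (f (v', t') $ i - (v' $ i + t' * d $ i))"
          by (intro dvd_diff fd that)
        then show ?thesis using eq by (simp add: vt algebra_simps)
      qed
      have "p dvd g v' - (g v + (t - t') * e v)"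
        using inv[OF rc[OF v'(1)] rc[OF v(1)] v(2) diff] by blast
      then have "p dvd (g v' - g v) - (g v' - (g v + (t - t') * e v))"
        using v(3) v'(3) by (intro dvd_diff[of _ "g v' - g v"]) simp_all
      then have "p dvd (t - t') * e v" by simp
      then have "p dvd t - t'" using unit[OF rc[OF v(1)] v(2)] p by (simp add: prime_dvd_mult_iff)
      then have t: "t = t'" using v v' by (metis mod_eq_dvd_iff mod_pos_pos_trivial)
      have "v' = v" using diff t by (intro residue_vecs_eqI[OF v'(1) v(1)]) simp
      then show "x = x'" using t by (simp add: vt)
    qed
    show "f ` (?A \<times> {0..<p}) = ?B"
    proof (intro equalityI subsetI)
      fix w assume "w \<in> f ` (?A \<times> {0..<p})"
      then obtain v t where v: "v \<in> residue_vecs n p" "P v" and w: "w = f (v, t)" by auto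
      show "w \<in> ?B" unfolding w using fr[of v t] inv[OF rc[OF fr[of v t]] rc[OF v(1)] v(2) fd] by blast
    next
      fix w assume "w \<in> ?B"
      then have w: "w \<in> residue_vecs n p" "P w" by auto
      obtain b where b: "p dvd e w * b - 1" using inverse_mod_prime[OF p unit[OF rc[OF w(1)] w(2)]] .
      \<comment> \<open>Modulo \<open>p\<close> this is g(w)/e(w), the time after which the line run
        backwards from \<open>w\<close> meets the zero set of \<open>g\<close>.\<close>
      define t where "t = (g w * b) mod p"
      define v where "v = reduce n p (\<lambda>i. w $ i + (- t) * d $ i)"
      have vr: "v \<in> residue_vecs n p" using p0 by (simp add: v_def reduce_residue_vecs)
      have vd: "p dvd v $ i - (w $ i + (- t) * d $ i)" if "i < n" for i
        unfolding v_def using reduce_dvd[OF that, of p "\<lambda>i. w $ i + (- t) * d $ i"] .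
      have Pv: "P v" "p dvd g v - (g w + (- t) * e w)"
        using inv[OF rc[OF vr] rc[OF w(1)] w(2) vd] by blast+
      have "p dvd t - g w * b" by (simp add: t_def dvd_mod_minus_self)
      then have "p dvd (g v - (g w + (- t) * e w)) - (t - g w * b) * e w - g w * (e w * b - 1)"
        by (intro dvd_diff[OF dvd_diff[OF Pv(2) dvd_mult2] dvd_mult[OF b]])
      then have "p dvd g v" by (simp add: algebra_simps)
      then have A: "(v, t) \<in> ?A \<times> {0..<p}" using vr Pv(1) p0 by (simp add: t_def)
      have "f (v, t) = w"
      proof (rule residue_vecs_eqI[OF fr w(1)])
        fix i assume i: "i < n"
        have "p dvd (f (v, t) $ i - (v $ i + t * d $ i)) + (v $ i - (w $ i + (- t) * d $ i))"
          by (intro dvd_add fd vd i)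
        then show "p dvd f (v, t) $ i - w $ i" by (simp add: algebra_simps)
      qed
      from this[symmetric] A show "w \<in> f ` (?A \<times> {0..<p})" by (rule image_eqI)
    qed
  qed
  then have "card ?B = card (?A \<times> {0..<p})" by (simp add: bij_betw_same_card)
  then show ?thesis by (simp add: card_cartesian_product mult.commute)
qed

text \<open>The shift principle is applied twice. Along e_j the function x . v has slope x_j, so
  p^(n-1) residue vectors are orthogonal to \<open>x\<close>. Along \<open>x\<close> itself v . v is
  affine since \<open>x\<close> is isotropic, with slope 2 (x . v), a unit off the orthogonal
  hyperplane because \<open>p\<close> is odd; so a fraction 1/p of those vectors is
  isotropic.\<close>

lemma card_isotropic_not_orthogonal:
  fixes p :: int
  assumes p: "prime p" "p \<noteq> 2" and x: "x \<in> carrier_vec n" "p dvd x \<bullet> x" and j: "j < n" "\<not> p dvd x $ j"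
  shows "nat p * nat p * card {v \<in> residue_vecs n p. \<not> p dvd x \<bullet> v \<and> p dvd v \<bullet> v} = nat p ^ n * (nat p - 1)"
proof -
  have p0: "0 < p" using prime_gt_0_int[OF p(1)] .
  have 1: "card {v \<in> residue_vecs n p. True} = nat p * card {v \<in> residue_vecs n p. True \<and> p dvd x \<bullet> v}"
  proof (rule card_residue_vecs_shift[OF p(1), where d = "unit_vec n j" and e = "\<lambda>_. x $ j"])
    fix u v :: "int vec" and t
    assume u: "u \<in> carrier_vec n" "v \<in> carrier_vec n" "\<And>i. i < n \<Longrightarrow> p dvd u $ i - (v $ i + t * unit_vec n j $ i)"
    have "p dvd x \<bullet> u - x \<bullet> (v + t \<cdot>\<^sub>v unit_vec n j)"
      using u x by (intro dvd_scalar_prod_diff[of _ n]) auto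
    then show "True \<and> p dvd x \<bullet> u - (x \<bullet> v + t * x $ j)"
      using x u j by (simp add: scalar_prod_add_distrib[of _ n])
  qed (use j in auto)
  have 2: "card {v \<in> residue_vecs n p. \<not> p dvd x \<bullet> v}
      = nat p * card {v \<in> residue_vecs n p. \<not> p dvd x \<bullet> v \<and> p dvd v \<bullet> v}"
  proof (rule card_residue_vecs_shift[OF p(1), where d = x and e = "\<lambda>v. 2 * (x \<bullet> v)"])
    fix u v :: "int vec" and t
    assume u: "u \<in> carrier_vec n" "v \<in> carrier_vec n" and nd: "\<not> p dvd x \<bullet> v"
      and d: "\<And>i. i < n \<Longrightarrow> p dvd u $ i - (v $ i + t * x $ i)"
    have c: "v + t \<cdot>\<^sub>v x \<in> carrier_vec n" and d': "\<forall>i<n. p dvd u $ i - (v + t \<cdot>\<^sub>v x) $ i"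
      using u x d by auto
    have a: "p dvd x \<bullet> u - (x \<bullet> v + t * (x \<bullet> x))"
      using dvd_scalar_prod_diff[OF u(1) c x(1) d'] x u by (simp add: scalar_prod_add_distrib[of _ n])
    have "\<not> p dvd x \<bullet> u"
    proof
      assume "p dvd x \<bullet> u"
      then have "p dvd x \<bullet> u - (x \<bullet> u - (x \<bullet> v + t * (x \<bullet> x))) - t * (x \<bullet> x)"
        by (intro dvd_diff[OF dvd_diff[OF _ a] dvd_mult[OF x(2)]])
      then show False using nd by simp
    qed
    moreover have "p dvd u \<bullet> u - (v \<bullet> v + t * (2 * (x \<bullet> v)))"
    proof -
      have "(v + t \<cdot>\<^sub>v x) \<bullet> (v + t \<cdot>\<^sub>v x) = v \<bullet> v + t * (2 * (x \<bullet> v)) + t * t * (x \<bullet> x)"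
        using u x comm_scalar_prod[of v n x]
        by (simp add: scalar_prod_add_distrib[of _ n] add_scalar_prod_distrib[of _ n] algebra_simps)
      then have "p dvd (u \<bullet> u - (v \<bullet> v + t * (2 * (x \<bullet> v)) + t * t * (x \<bullet> x))) + t * t * (x \<bullet> x)"
        using dvd_scalar_prod_self_diff[OF u(1) c d'] x(2) by (intro dvd_add dvd_mult) simp_all
      then show ?thesis by (simp add: algebra_simps)
    qed
    ultimately show "\<not> p dvd x \<bullet> u \<and> p dvd u \<bullet> u - (v \<bullet> v + t * (2 * (x \<bullet> v)))" ..
  next
    fix v assume "\<not> p dvd x \<bullet> v"
    moreover have "\<not> p dvd 2" using p primes_dvd_imp_eq[of p 2] by auto
    ultimately show "\<not> p dvd 2 * (x \<bullet> v)" using p(1) by (simp add: prime_dvd_mult_iff)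
  qed
  define R O' T T0 where "R = residue_vecs n p" and "O' = {v \<in> R. p dvd x \<bullet> v}"
    and "T = {v \<in> R. \<not> p dvd x \<bullet> v}" and "T0 = {v \<in> R. \<not> p dvd x \<bullet> v \<and> p dvd v \<bullet> v}"
  have fin: "finite R" and cR: "card R = nat p ^ n" using card_residue_vecs by (auto simp: R_def)
  have "card R = nat p * card O'" using 1 by (simp add: R_def O'_def)
  moreover have "card R = card O' + card T"
  proof -
    have "R = O' \<union> T" "O' \<inter> T = {}" by (auto simp: O'_def T_def)
    then show ?thesis using fin by (metis card_Un_disjoint finite_Un)
  qed
  moreover have "card T = nat p * card T0" using 2 by (simp add: R_def T_def T0_def)
  ultimately have "nat p * (nat p * card T0) + card R = nat p * card R"
    by (metis add.commute distrib_left)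
  moreover have "nat p * card R = (nat p - 1) * card R + card R"
    using p0 by (metis Suc_pred' add.commute mult_Suc zero_less_nat_eq)
  ultimately have "nat p * nat p * card T0 = card R * (nat p - 1)" by (simp add: ac_simps)
  then show ?thesis unfolding cR unfolding T0_def R_def .
qed

section \<open>Representations of \<open>p\<^sup>2k\<close> by sums of squares\<close>

definition prim_reps :: "nat \<Rightarrow> int \<Rightarrow> int \<Rightarrow> int vec set" where
  "prim_reps n p k = {x \<in> reps n k. \<exists>i<n. \<not> p dvd x $ i}"

definition isotropic :: "nat \<Rightarrow> int \<Rightarrow> int vec set" where
  "isotropic n p = {v \<in> residue_vecs n p. (\<exists>i<n. \<not> p dvd v $ i) \<and> p dvd v \<bullet> v}"

lemma isotropic_lift:
  fixes p :: int
  assumes p: "prime p" "p \<noteq> 2" and v: "v \<in> carrier_vec n" "p dvd v \<bullet> v" and i: "i < n" "\<not> p dvd v $ i"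
  obtains w where "w \<in> carrier_vec n" "\<forall>i<n. p dvd w $ i - v $ i" "p\<^sup>2 dvd w \<bullet> w"
proof -
  obtain s where s: "v \<bullet> v = p * s" using v(2) ..
  have "\<not> p dvd 2" using p primes_dvd_imp_eq[of p 2] by auto
  then have "\<not> p dvd 2 * v $ i" using p i by (simp add: prime_dvd_mult_iff)
  then obtain b where b: "p dvd 2 * v $ i * b - 1" using inverse_mod_prime[OF p(1)] by blast
  \<comment> \<open>A Hensel step: moving v_i by p t changes the norm by 2 p t v_i modulo p^2, and
    this \<open>t\<close> solves s + 2 t v_i = 0 modulo \<open>p\<close>.\<close>
  define t where "t = - s * b"
  define w where "w = v + (p * t) \<cdot>\<^sub>v unit_vec n i"
  have "w \<bullet> w = v \<bullet> v + 2 * (p * t) * v $ i + (p * t) * (p * t)"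
    using v i by (simp add: w_def scalar_prod_add_distrib[of _ n] add_scalar_prod_distrib[of _ n] algebra_simps)
  also have "\<dots> = p * (- s * (2 * v $ i * b - 1)) + p\<^sup>2 * (t * t)"
    by (simp add: s t_def power2_eq_square algebra_simps)
  finally have "w \<bullet> w = p * (- s * (2 * v $ i * b - 1)) + p\<^sup>2 * (t * t)" .
  moreover have "p\<^sup>2 dvd p * (- s * (2 * v $ i * b - 1))"
    unfolding power2_eq_square by (intro mult_dvd_mono dvd_refl dvd_mult b)
  ultimately have "p\<^sup>2 dvd w \<bullet> w" by simp
  moreover have "w \<in> carrier_vec n" "\<forall>i<n. p dvd w $ i - v $ i" using v i by (auto simp: w_def)
  ultimately show thesis using that by blast
qed

text \<open>As \<open>y\<close> is nonzero modulo \<open>p\<close>, the scalar relating it to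
  \<open>v\<close> is a unit, so the admissible \<open>v\<close> are the p - 1 nonzero multiples of
  \<open>y\<close> modulo \<open>p\<close>.\<close>

lemma card_isotropic_multiples:
  fixes p :: int
  assumes p: "prime p" and y: "y \<in> carrier_vec n" "p dvd y \<bullet> y" and j: "j < n" "\<not> p dvd y $ j"
  shows "card {v \<in> isotropic n p. \<exists>a. \<forall>i<n. p dvd y $ i - a * v $ i} = nat p - 1"
proof -
  have p0: "0 < p" using prime_gt_0_int[OF p] .
  define f where "f b = reduce n p (\<lambda>i. b * y $ i)" for b
  have fr: "f b \<in> residue_vecs n p" for b using p0 by (simp add: f_def reduce_residue_vecs)
  have fc: "f b \<in> carrier_vec n" for b using fr by (simp add: residue_vecs_def)
  have fd: "p dvd f b $ i - b * y $ i" if "i < n" for b i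
    unfolding f_def using reduce_dvd[OF that, of p "\<lambda>i. b * y $ i"] .
  have "bij_betw f {1..<p} {v \<in> isotropic n p. \<exists>a. \<forall>i<n. p dvd y $ i - a * v $ i}"
    unfolding bij_betw_def
  proof
    show "inj_on f {1..<p}"
    proof (rule inj_onI)
      fix b b' assume b: "b \<in> {1..<p}" "b' \<in> {1..<p}" and "f b = f b'"
      then have "p dvd (f b' $ j - b' * y $ j) - (f b $ j - b * y $ j)" using j by (intro dvd_diff[OF fd fd])
      then have "p dvd (b - b') * y $ j" using \<open>f b = f b'\<close> by (simp add: algebra_simps)
      then have "p dvd b - b'" using p j by (simp add: prime_dvd_mult_iff)
      then have "b mod p = b' mod p" by (simp add: mod_eq_dvd_iff)
      then show "b = b'" using b by simp
    qed
    show "f ` {1..<p} = {v \<in> isotropic n p. \<exists>a. \<forall>i<n. p dvd y $ i - a * v $ i}"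
    proof (intro equalityI subsetI)
      fix v assume "v \<in> f ` {1..<p}"
      then obtain b where b: "1 \<le> b" "b < p" and v: "v = f b" by auto
      have pb: "\<not> p dvd b" using b by (simp add: zdvd_not_zless)
      obtain c where c: "p dvd b * c - 1" using inverse_mod_prime[OF p pb] .
      have "\<not> p dvd f b $ j"
      proof
        assume "p dvd f b $ j"
        then have "p dvd f b $ j - (f b $ j - b * y $ j)" by (intro dvd_diff[OF _ fd] j)
        then show False using p pb j by (simp add: prime_dvd_mult_iff)
      qed
      moreover have "p dvd f b \<bullet> f b"
      proof -
        have "\<forall>i<n. p dvd f b $ i - (b \<cdot>\<^sub>v y) $ i" using fd y by simp
        then have 1: "p dvd f b \<bullet> f b - (b \<cdot>\<^sub>v y) \<bullet> (b \<cdot>\<^sub>v y)"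
          using fc y by (intro dvd_scalar_prod_self_diff[of _ n]) auto
        have 2: "p dvd (b \<cdot>\<^sub>v y) \<bullet> (b \<cdot>\<^sub>v y)" using y by simp
        show ?thesis using dvd_add[OF 1 2] by (simp only: diff_add_cancel)
      qed
      moreover have "p dvd y $ i - c * f b $ i" if "i < n" for i
      proof -
        have "p dvd - (y $ i * (b * c - 1)) - c * (f b $ i - b * y $ i)"
          using that by (intro dvd_diff[OF dvd_minus_iff[THEN iffD2, OF dvd_mult[OF c]] dvd_mult[OF fd]])
        then show ?thesis by (simp add: algebra_simps)
      qed
      ultimately show "v \<in> {v \<in> isotropic n p. \<exists>a. \<forall>i<n. p dvd y $ i - a * v $ i}"
        unfolding v isotropic_def using fr j by blast
    next
      fix v assume "v \<in> {v \<in> isotropic n p. \<exists>a. \<forall>i<n. p dvd y $ i - a * v $ i}"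
      then obtain a where v: "v \<in> residue_vecs n p" and a: "\<And>i. i < n \<Longrightarrow> p dvd y $ i - a * v $ i"
        by (auto simp: isotropic_def)
      have pa: "\<not> p dvd a"
      proof
        assume "p dvd a"
        then have "p dvd (y $ j - a * v $ j) + a * v $ j" by (intro dvd_add[OF a dvd_mult2] j)
        then show False using j by simp
      qed
      obtain c where c: "p dvd a * c - 1" using inverse_mod_prime[OF p pa] .
      define b where "b = c mod p"
      have bc: "p dvd b - c" by (simp add: b_def dvd_mod_minus_self)
      have "b \<noteq> 0"
      proof
        assume "b = 0"
        then have "p dvd c" using bc by simp
        then have "p dvd a * c - (a * c - 1)" by (intro dvd_diff[OF dvd_mult c])
        then show False using prime_gt_1_int[OF p] by simp
      qed
      moreover have "0 \<le> b" "b < p" using p0 by (simp_all add: b_def)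
      ultimately have "b \<in> {1..<p}" by simp
      moreover have "f b = v"
      proof (rule residue_vecs_eqI[OF fr v])
        fix i assume i: "i < n"
        have "p dvd (f b $ i - b * y $ i) + (b - c) * y $ i + c * (y $ i - a * v $ i) + v $ i * (a * c - 1)"
          by (intro dvd_add[OF dvd_add[OF dvd_add[OF fd dvd_mult2[OF bc]] dvd_mult[OF a]] dvd_mult[OF c]] i)
        then show "p dvd f b $ i - v $ i" by (simp add: algebra_simps)
      qed
      ultimately show "v \<in> f ` {1..<p}" by blast
    qed
  qed
  then have "card {v \<in> isotropic n p. \<exists>a. \<forall>i<n. p dvd y $ i - a * v $ i} = card {1..<p}"
    by (rule bij_betw_same_card[symmetric])
  then show ?thesis by (simp add: nat_diff_distrib')
qed

lemma dvd_scalar_prod_cong: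
  fixes u u' w :: "int vec"
  assumes "u \<in> carrier_vec n" "u' \<in> carrier_vec n" "w \<in> carrier_vec n" "\<forall>i<n. m dvd u $ i - u' $ i"
  shows "m dvd w \<bullet> u \<longleftrightarrow> m dvd w \<bullet> u'"
  using dvd_scalar_prod_diff[OF assms] dvd_add[of m "w \<bullet> u - w \<bullet> u'" "w \<bullet> u'"]
    dvd_diff[of m "w \<bullet> u" "w \<bullet> u - w \<bullet> u'"] by auto

lemma smult_reps:
  assumes "p \<noteq> 0"
  shows "{y \<in> reps n (p\<^sup>2 * k). \<forall>i<n. p dvd y $ i} = (\<lambda>x. p \<cdot>\<^sub>v x) ` reps n k"
    and "inj_on (\<lambda>x. p \<cdot>\<^sub>v x) (reps n k)"
proof -
  have norm: "(p \<cdot>\<^sub>v x) \<bullet> (p \<cdot>\<^sub>v x) = p\<^sup>2 * (x \<bullet> x)" if "x \<in> carrier_vec n" for x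
    using that by (simp add: power2_eq_square)
  show "{y \<in> reps n (p\<^sup>2 * k). \<forall>i<n. p dvd y $ i} = (\<lambda>x. p \<cdot>\<^sub>v x) ` reps n k"
  proof (intro equalityI subsetI)
    fix y assume y: "y \<in> {y \<in> reps n (p\<^sup>2 * k). \<forall>i<n. p dvd y $ i}"
    define x where "x = vec n (\<lambda>i. y $ i div p)"
    have xc: "x \<in> carrier_vec n" by (simp add: x_def)
    have yx: "y = p \<cdot>\<^sub>v x" using y by (intro eq_vecI) (auto simp: x_def reps_def)
    have "p\<^sup>2 * (x \<bullet> x) = p\<^sup>2 * k" using y norm[OF xc] by (simp add: yx reps_def)
    then have "x \<in> reps n k" using xc assms by (simp add: reps_def)
    then show "y \<in> (\<lambda>x. p \<cdot>\<^sub>v x) ` reps n k" using yx by blast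
  next
    fix y assume "y \<in> (\<lambda>x. p \<cdot>\<^sub>v x) ` reps n k"
    then obtain x where x: "x \<in> carrier_vec n" "x \<bullet> x = k" "y = p \<cdot>\<^sub>v x" by (auto simp: reps_def)
    then show "y \<in> {y \<in> reps n (p\<^sup>2 * k). \<forall>i<n. p dvd y $ i}" using norm[OF x(1)] by (simp add: reps_def)
  qed
  show "inj_on (\<lambda>x. p \<cdot>\<^sub>v x) (reps n k)"
  proof (rule inj_onI)
    fix x x' assume x: "x \<in> reps n k" "x' \<in> reps n k" and eq: "p \<cdot>\<^sub>v x = p \<cdot>\<^sub>v x'"
    have c: "x \<in> carrier_vec n" "x' \<in> carrier_vec n" using x by (auto simp: reps_def)
    show "x = x'"
    proof (rule eq_vecI)
      fix i assume i: "i < dim_vec x'"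
      have "(p \<cdot>\<^sub>v x) $ i = (p \<cdot>\<^sub>v x') $ i" by (simp only: eq)
      then show "x $ i = x' $ i" using c i assms by simp
    qed (use c in simp)
  qed
qed

text \<open>The scaled neighbour has as many vectors of norm p^2 k as the standard lattice has of
  norm k. Among the former, those divisible by \<open>p\<close> are the p x with x orthogonal to
  \<open>v\<close> modulo \<open>p\<close>; removing these x on both sides leaves the claim.\<close>

lemma card_neighbour_prim:
  fixes p k :: int
  assumes p: "prime p" "p \<noteq> 2" and n: "n \<le> 5" and v: "v \<in> isotropic n p"
  shows "card {y \<in> prim_reps n p (p\<^sup>2 * k). \<exists>a. \<forall>i<n. p dvd y $ i - a * v $ i}
    = card {x \<in> prim_reps n p k. \<not> p dvd x \<bullet> v}"
proof -
  have p0: "p \<noteq> 0" using p by auto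
  have vc: "v \<in> carrier_vec n" and vv: "p dvd v \<bullet> v" using v by (auto simp: isotropic_def residue_vecs_def)
  obtain i where i: "i < n" "\<not> p dvd v $ i" using v by (auto simp: isotropic_def)
  \<comment> \<open>A residue vector is isotropic only modulo \<open>p\<close>, whereas the
    neighbour needs a norm divisible by p^2.\<close>
  obtain w where wc: "w \<in> carrier_vec n" and wv: "\<forall>i<n. p dvd w $ i - v $ i" and ww: "p\<^sup>2 dvd w \<bullet> w"
    using isotropic_lift[OF p vc vv i] .
  define A where "A = {y \<in> prim_reps n p (p\<^sup>2 * k). \<exists>a. \<forall>i<n. p dvd y $ i - a * v $ i}"
  define B where "B = {x \<in> prim_reps n p k. \<not> p dvd x \<bullet> v}"
  define C where "C = {x \<in> reps n k. p dvd x \<bullet> v}"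
  have "\<not> p dvd w $ i"
  proof
    assume "p dvd w $ i"
    then have "p dvd w $ i - (w $ i - v $ i)" by (intro dvd_diff[OF _ wv[rule_format, OF i(1)]])
    then show False using i by simp
  qed
  then have "card {y \<in> neighbour n p w. y \<bullet> y = p\<^sup>2 * k} = card (reps n k)"
    using card_neighbour[OF p(1) n wc ww] i by blast
  moreover have "{y \<in> neighbour n p w. y \<bullet> y = p\<^sup>2 * k} = A \<union> (\<lambda>x. p \<cdot>\<^sub>v x) ` C"
  proof -
    have cong: "(\<exists>a. \<forall>i<n. p dvd y $ i - a * w $ i) \<longleftrightarrow> (\<exists>a. \<forall>i<n. p dvd y $ i - a * v $ i)" for y
    proof -
      have "p dvd y $ i - a * w $ i \<longleftrightarrow> p dvd y $ i - a * v $ i" if "i < n" for a i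
      proof -
        have "p dvd a * (w $ i - v $ i)" using wv that by simp
        moreover have "y $ i - a * v $ i = (y $ i - a * w $ i) + a * (w $ i - v $ i)"
          by (simp add: algebra_simps)
        ultimately show ?thesis by (simp only: dvd_add_left_iff)
      qed
      then show ?thesis by blast
    qed
    have prim: "y \<in> neighbour n p w \<longleftrightarrow> (\<exists>a. \<forall>i<n. p dvd y $ i - a * v $ i)"
      if y: "y \<in> prim_reps n p (p\<^sup>2 * k)" for y
    proof -
      have yc: "y \<in> carrier_vec n" and yy: "y \<bullet> y = p\<^sup>2 * k" using y by (auto simp: prim_reps_def reps_def)
      obtain j where j: "j < n" "\<not> p dvd y $ j" using y by (auto simp: prim_reps_def)
      \<comment> \<open>The second neighbour condition is automatic here: with y = a w + p u the
        norm p^2 k forces \<open>p\<close> to divide 2 a (u . w), where 2 and \<open>a\<close> are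
        units.\<close>
      have "p\<^sup>2 dvd y \<bullet> w" if ex: "\<exists>a. \<forall>i<n. p dvd y $ i - a * w $ i"
      proof -
        obtain a where a: "\<forall>i<n. p dvd y $ i - a * w $ i" using ex by blast
        define u where "u = vec n (\<lambda>i. (y $ i - a * w $ i) div p)"
        have uc: "u \<in> carrier_vec n" by (simp add: u_def)
        have yu: "y = a \<cdot>\<^sub>v w + p \<cdot>\<^sub>v u" using yc wc a by (intro eq_vecI) (auto simp: u_def)
        have pa: "\<not> p dvd a"
        proof
          assume "p dvd a"
          then have "p dvd (y $ j - a * w $ j) + a * w $ j" using a j by (intro dvd_add[OF _ dvd_mult2]) auto
          then show False using j by simp
        qed
        have "y \<bullet> y = a * a * (w \<bullet> w) + p * (2 * a * (u \<bullet> w)) + p\<^sup>2 * (u \<bullet> u)"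
          unfolding yu using wc uc comm_scalar_prod[of w n u]
          by (simp add: scalar_prod_add_distrib[of _ n] add_scalar_prod_distrib[of _ n] power2_eq_square algebra_simps)
        then have "p * (2 * a * (u \<bullet> w)) = p\<^sup>2 * k - a * a * (w \<bullet> w) - p\<^sup>2 * (u \<bullet> u)"
          using yy by simp
        also have "p\<^sup>2 dvd \<dots>" using ww by simp
        finally have "p dvd 2 * a * (u \<bullet> w)" using p0 by (simp add: power2_eq_square)
        moreover have "\<not> p dvd 2" using p primes_dvd_imp_eq[of p 2] by auto
        ultimately have uw: "p dvd u \<bullet> w" using p(1) pa by (simp add: prime_dvd_mult_iff)
        have "y \<bullet> w = a * (w \<bullet> w) + p * (u \<bullet> w)"
          unfolding yu using wc uc by (simp add: add_scalar_prod_distrib[of _ n])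
        moreover have "p\<^sup>2 dvd p * (u \<bullet> w)" using uw by (simp add: power2_eq_square)
        ultimately show ?thesis using ww by simp
      qed
      then show ?thesis using yc cong[of y] unfolding neighbour_def by blast
    qed
    have mult: "p \<cdot>\<^sub>v x \<in> neighbour n p w \<longleftrightarrow> p dvd x \<bullet> v" if x: "x \<in> carrier_vec n" for x
    proof -
      have "\<forall>i<n. p dvd (p \<cdot>\<^sub>v x) $ i - 0 * w $ i" using x by simp
      moreover have "p \<cdot>\<^sub>v x \<in> carrier_vec n" using x by simp
      ultimately have "p \<cdot>\<^sub>v x \<in> neighbour n p w \<longleftrightarrow> p\<^sup>2 dvd (p \<cdot>\<^sub>v x) \<bullet> w"
        unfolding neighbour_def by blast
      also have "\<dots> \<longleftrightarrow> p dvd x \<bullet> w" using x wc p0 by (simp add: power2_eq_square)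
      also have "\<dots> \<longleftrightarrow> p dvd x \<bullet> v" by (rule dvd_scalar_prod_cong[OF wc vc x wv])
      finally show ?thesis .
    qed
    have "{y \<in> neighbour n p w. y \<bullet> y = p\<^sup>2 * k}
       = {y \<in> prim_reps n p (p\<^sup>2 * k). y \<in> neighbour n p w} \<union> {y \<in> {y \<in> reps n (p\<^sup>2 * k). \<forall>i<n. p dvd y $ i}. y \<in> neighbour n p w}"
      unfolding prim_reps_def reps_def neighbour_def by blast
    also have "{y \<in> prim_reps n p (p\<^sup>2 * k). y \<in> neighbour n p w} = A" unfolding A_def using prim by blast
    also have "{y \<in> {y \<in> reps n (p\<^sup>2 * k). \<forall>i<n. p dvd y $ i}. y \<in> neighbour n p w} = (\<lambda>x. p \<cdot>\<^sub>v x) ` C"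
      unfolding smult_reps(1)[OF p0] C_def using mult unfolding reps_def by blast
    finally show ?thesis .
  qed
  moreover have "card (A \<union> (\<lambda>x. p \<cdot>\<^sub>v x) ` C) = card A + card C"
  proof -
    have "C \<subseteq> reps n k" by (auto simp: C_def)
    then have "finite C" using finite_reps by (rule finite_subset)
    moreover have "card ((\<lambda>x. p \<cdot>\<^sub>v x) ` C) = card C"
      by (rule card_image[OF inj_on_subset[OF smult_reps(2)[OF p0] \<open>C \<subseteq> reps n k\<close>]])
    moreover have "finite A"
      by (rule finite_subset[OF _ finite_reps[of n "p\<^sup>2 * k"]]) (auto simp: A_def prim_reps_def)
    moreover have "A \<inter> (\<lambda>x. p \<cdot>\<^sub>v x) ` C = {}"
    proof -
      have "(\<lambda>x. p \<cdot>\<^sub>v x) ` C \<subseteq> {y \<in> reps n (p\<^sup>2 * k). \<forall>i<n. p dvd y $ i}"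
        unfolding smult_reps(1)[OF p0] using \<open>C \<subseteq> reps n k\<close> by blast
      then show ?thesis unfolding A_def prim_reps_def by blast
    qed
    ultimately show ?thesis by (simp add: card_Un_disjoint)
  qed
  moreover have "card (reps n k) = card B + card C"
  proof -
    have "x \<in> prim_reps n p k" if x: "x \<in> reps n k" "\<not> p dvd x \<bullet> v" for x
    proof (rule ccontr)
      assume "x \<notin> prim_reps n p k"
      then have xi: "\<forall>i<n. p dvd x $ i" using x by (auto simp: prim_reps_def)
      have "p dvd x \<bullet> v"
        unfolding scalar_prod_def using xi vc by (intro dvd_sum dvd_mult2) auto
      then show False using x by simp
    qed
    then have "reps n k = B \<union> C" by (auto simp: B_def C_def prim_reps_def)
    moreover have "B \<inter> C = {}" by (auto simp: B_def C_def)
    ultimately show ?thesis using finite_reps[of n k] by (metis card_Un_disjoint finite_Un)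
  qed
  ultimately show ?thesis unfolding A_def[symmetric] B_def[symmetric] by simp
qed

text \<open>Double counting of pairs with an isotropic \<open>v\<close>: each primitive
  \<open>y\<close> is a multiple of exactly p - 1 of them, while each primitive \<open>x\<close> is
  isotropic because \<open>p\<close> divides \<open>k\<close>, so
  \<open>card_isotropic_not_orthogonal\<close> counts the \<open>v\<close> not orthogonal to it.
  Keeping the factor p^2 on the left avoids the exponent n - 2.\<close>

theorem card_prim_reps_square:
  fixes p k :: int
  assumes p: "prime p" "p \<noteq> 2" and n: "n \<le> 5" and k: "p dvd k"
  shows "nat p ^ 2 * card (prim_reps n p (p\<^sup>2 * k)) = nat p ^ n * card (prim_reps n p k)"
proof -
  have p1: "1 < p" using prime_gt_1_int[OF p(1)] .
  define V where "V = isotropic n p"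
  have finV: "finite V"
    by (rule finite_subset[of _ "residue_vecs n p"]) (auto simp: V_def isotropic_def card_residue_vecs)
  have fin: "finite (prim_reps n p m)" for m
    by (rule finite_subset[OF _ finite_reps[of n m]]) (auto simp: prim_reps_def)
  have "(\<Sum>v\<in>V. card {y \<in> prim_reps n p (p\<^sup>2 * k). \<exists>a. \<forall>i<n. p dvd y $ i - a * v $ i})
     = (\<Sum>y\<in>prim_reps n p (p\<^sup>2 * k). nat p - 1)"
  proof (rule sum_multicount_gen[OF finV fin], intro ballI)
    fix y assume y: "y \<in> prim_reps n p (p\<^sup>2 * k)"
    then obtain j where "j < n" "\<not> p dvd y $ j" by (auto simp: prim_reps_def)
    moreover have "y \<in> carrier_vec n" "p dvd y \<bullet> y" using y by (auto simp: prim_reps_def reps_def power2_eq_square)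
    ultimately show "card {v \<in> V. \<exists>a. \<forall>i<n. p dvd y $ i - a * v $ i} = nat p - 1"
      unfolding V_def by (intro card_isotropic_multiples[OF p(1)])
  qed
  moreover have "nat p ^ 2 * (\<Sum>v\<in>V. card {x \<in> prim_reps n p k. \<not> p dvd x \<bullet> v})
     = (\<Sum>x\<in>prim_reps n p k. nat p ^ n * (nat p - 1))"
  proof -
    have "(\<Sum>v\<in>V. card {x \<in> prim_reps n p k. \<not> p dvd x \<bullet> v}) = (\<Sum>x\<in>prim_reps n p k. card {v \<in> V. \<not> p dvd x \<bullet> v})"
      by (rule sum_multicount_gen[OF finV fin]) simp
    moreover have "nat p ^ 2 * card {v \<in> V. \<not> p dvd x \<bullet> v} = nat p ^ n * (nat p - 1)" if x: "x \<in> prim_reps n p k" for x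
    proof -
      obtain j where j: "j < n" "\<not> p dvd x $ j" using x by (auto simp: prim_reps_def)
      have xc: "x \<in> carrier_vec n" "p dvd x \<bullet> x" using x k by (auto simp: prim_reps_def reps_def)
      have "\<exists>i<n. \<not> p dvd v $ i" if "\<not> p dvd x \<bullet> v" "v \<in> carrier_vec n" for v
      proof (rule ccontr)
        assume "\<not> (\<exists>i<n. \<not> p dvd v $ i)"
        then have "p dvd x \<bullet> v" unfolding scalar_prod_def using that(2) by (intro dvd_sum dvd_mult) auto
        then show False using that(1) by simp
      qed
      then have "{v \<in> V. \<not> p dvd x \<bullet> v} = {v \<in> residue_vecs n p. \<not> p dvd x \<bullet> v \<and> p dvd v \<bullet> v}"
        unfolding V_def isotropic_def residue_vecs_def by blast
      then show ?thesis
        using card_isotropic_not_orthogonal[OF p xc j] by (simp add: power2_eq_square)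
    qed
    ultimately show ?thesis by (simp add: sum_distrib_left)
  qed
  moreover have "(\<Sum>v\<in>V. card {y \<in> prim_reps n p (p\<^sup>2 * k). \<exists>a. \<forall>i<n. p dvd y $ i - a * v $ i})
     = (\<Sum>v\<in>V. card {x \<in> prim_reps n p k. \<not> p dvd x \<bullet> v})"
    by (intro sum.cong refl card_neighbour_prim[OF p n]) (simp add: V_def)
  ultimately have "nat p ^ 2 * (\<Sum>y\<in>prim_reps n p (p\<^sup>2 * k). nat p - 1)
     = (\<Sum>x\<in>prim_reps n p k. nat p ^ n * (nat p - 1))" by (simp only:)
  then have "(nat p ^ 2 * card (prim_reps n p (p\<^sup>2 * k))) * (nat p - 1)
     = (nat p ^ n * card (prim_reps n p k)) * (nat p - 1)"
    by (simp only: sum_constant of_nat_id ac_simps)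
  moreover have "\<not> nat p \<le> Suc 0" using p1 by linarith
  ultimately show ?thesis by simp
qed

lemma card_reps_square:
  fixes p k :: int
  assumes "p \<noteq> 0"
  shows "card (reps n (p\<^sup>2 * k)) = card (prim_reps n p (p\<^sup>2 * k)) + card (reps n k)"
proof -
  let ?S = "{y \<in> reps n (p\<^sup>2 * k). \<forall>i<n. p dvd y $ i}"
  have eq: "reps n (p\<^sup>2 * k) = prim_reps n p (p\<^sup>2 * k) \<union> ?S"
    unfolding prim_reps_def by blast
  have fin: "finite (prim_reps n p (p\<^sup>2 * k))" "finite ?S"
    unfolding prim_reps_def by (rule finite_subset[OF _ finite_reps[of n "p\<^sup>2 * k"]], blast)+
  have "prim_reps n p (p\<^sup>2 * k) \<inter> ?S = {}" unfolding prim_reps_def by blast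
  from card_Un_disjoint[OF fin this]
  have "card (reps n (p\<^sup>2 * k)) = card (prim_reps n p (p\<^sup>2 * k)) + card ?S"
    by (simp only: eq[symmetric])
  also have "card ?S = card (reps n k)" unfolding smult_reps(1)[OF assms] by (rule card_image[OF smult_reps(2)[OF assms]])
  finally show ?thesis .
qed

lemma prim_reps_eq_reps:
  fixes p k :: int
  assumes "\<not> p\<^sup>2 dvd k" shows "prim_reps n p k = reps n k"
proof -
  have "\<exists>i<n. \<not> p dvd x $ i" if x: "x \<in> reps n k" for x
  proof (rule ccontr)
    assume *: "\<not> (\<exists>i<n. \<not> p dvd x $ i)"
    have "p\<^sup>2 dvd x \<bullet> x"
      unfolding scalar_prod_def power2_eq_square using * x by (intro dvd_sum mult_dvd_mono) (auto simp: reps_def)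
    then show False using assms x by (simp add: reps_def)
  qed
  then show ?thesis unfolding prim_reps_def by blast
qed

text \<open>A representation divisible by \<open>p\<close> is \<open>p\<close> times one with
  exponent lowered by 2, so all representations are a sum of primitive counts, which grow by p^(5-2)
  per step. At the bottom, p k is not divisible by p^2 and all representations are
  primitive.\<close>

theorem card_reps_5_prime_power:
  fixes p k :: int
  assumes p: "prime p" "p \<noteq> 2" and k: "\<not> p dvd k"
  shows "int (card (reps 5 (p ^ (2 * j + 1) * k))) = int (card (reps 5 (p * k))) * (\<Sum>i\<le>j. (p ^ 3) ^ i)"
proof -
  have p0: "0 < p" using prime_gt_0_int[OF p(1)] .
  have rw: "p\<^sup>2 * (p ^ (2 * j + 1) * k) = p ^ (2 * Suc j + 1) * k" for j by (simp add: power2_eq_square ac_simps)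
  have "\<not> p\<^sup>2 dvd p * k" using k p0 by (simp add: power2_eq_square)
  then have base: "prim_reps 5 p (p * k) = reps 5 (p * k)" by (rule prim_reps_eq_reps)
  have prim: "int (card (prim_reps 5 p (p ^ (2 * j + 1) * k))) = (p ^ 3) ^ j * int (card (reps 5 (p * k)))" for j
  proof (induction j)
    case 0
    then show ?case by (simp add: base)
  next
    case (Suc j)
    have "nat p ^ 2 * card (prim_reps 5 p (p\<^sup>2 * (p ^ (2 * j + 1) * k))) = nat p ^ 5 * card (prim_reps 5 p (p ^ (2 * j + 1) * k))"
      by (rule card_prim_reps_square[OF p]) auto
    then have "int (nat p ^ 2 * card (prim_reps 5 p (p\<^sup>2 * (p ^ (2 * j + 1) * k)))) = int (nat p ^ 5 * card (prim_reps 5 p (p ^ (2 * j + 1) * k)))"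
      by (simp only:)
    then have "p ^ 2 * int (card (prim_reps 5 p (p\<^sup>2 * (p ^ (2 * j + 1) * k)))) = p ^ 5 * int (card (prim_reps 5 p (p ^ (2 * j + 1) * k)))"
      using p0 by (simp only: of_nat_mult of_nat_power int_nat_eq) simp
    also have "\<dots> = p ^ 2 * (p ^ 3 * int (card (prim_reps 5 p (p ^ (2 * j + 1) * k))))"
      by (simp add: eval_nat_numeral)
    finally have eq: "p ^ 2 * int (card (prim_reps 5 p (p\<^sup>2 * (p ^ (2 * j + 1) * k)))) = p ^ 2 * (p ^ 3 * int (card (prim_reps 5 p (p ^ (2 * j + 1) * k))))" .
    have "p ^ 2 \<noteq> 0" using p0 by simp
    then have "int (card (prim_reps 5 p (p\<^sup>2 * (p ^ (2 * j + 1) * k)))) = p ^ 3 * int (card (prim_reps 5 p (p ^ (2 * j + 1) * k)))"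
      by (rule mult_left_cancel[THEN iffD1, OF _ eq])
    then show ?case unfolding rw Suc.IH by simp
  qed
  show ?thesis
  proof (induction j)
    case 0
    then show ?case by simp
  next
    case (Suc j)
    have "int (card (reps 5 (p\<^sup>2 * (p ^ (2 * j + 1) * k))))
       = int (card (prim_reps 5 p (p\<^sup>2 * (p ^ (2 * j + 1) * k)))) + int (card (reps 5 (p ^ (2 * j + 1) * k)))"
      using card_reps_square[of p 5 "p ^ (2 * j + 1) * k"] p0 by simp
    then show ?case unfolding rw Suc.IH prim by (simp only: sum.atMost_Suc distrib_left mult.commute add.commute)
  qed
qed

section \<open>Proof of the congruences\<close>

lemma graded_carrier_vec: "graded (carrier_vec n) (\<lambda>x. x \<bullet> x)"
  unfolding graded_def using finite_reps[unfolded reps_def] scalar_prod_self_nonneg by blast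

lemma counting_fps_carrier_vec: "counting_fps (carrier_vec n) (\<lambda>x. x \<bullet> x) = theta ^ n"
proof (induction n)
  case 0
  have "{x \<in> carrier_vec 0. x \<bullet> x = int k} = (if k = 0 then {vNil} else {})" for k
    by (auto simp: scalar_prod_def)
  then show ?case by (intro fps_ext) (simp add: counting_fps_def)
next
  case (Suc n)
  let ?h = "\<lambda>(a, x). vCons a x :: int vec"
  have "bij_betw ?h (UNIV \<times> carrier_vec n) (carrier_vec (Suc n))"
    unfolding bij_betw_def
  proof
    show "inj_on ?h (UNIV \<times> carrier_vec n)" by (auto simp: inj_on_def)
    show "?h ` (UNIV \<times> carrier_vec n) = carrier_vec (Suc n)"
    proof (intro equalityI subsetI)
      fix x :: "int vec" assume "x \<in> carrier_vec (Suc n)"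
      then obtain a y where "x = vCons a y" "y \<in> carrier_vec n" by (rule carrier_vec_SucE)
      then show "x \<in> ?h ` (UNIV \<times> carrier_vec n)" by (intro image_eqI[of _ _ "(a, y)"]) auto
    qed auto
  qed
  then have "counting_fps (UNIV \<times> carrier_vec n) (\<lambda>(a, x). a\<^sup>2 + x \<bullet> x) = counting_fps (carrier_vec (Suc n)) (\<lambda>x. x \<bullet> x)"
    by (rule counting_fps_bij_betw) (auto simp: power2_eq_square)
  then show ?case
    using counting_fps_Times[OF graded_square graded_carrier_vec, of UNIV n] Suc.IH by (simp add: theta_counting)
qed

lemma card_reps_theta: "int (card (reps n (int k))) = fps_nth (theta ^ n) k"
  by (simp add: counting_fps_carrier_vec[symmetric] counting_fps_def reps_def)

text \<open>Since \<open>d\<close> divides 9, the congruence with \<open>theta ^ 5\<close> holds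
  modulo \<open>d\<close>, where the coefficient vanishes by the geometric factor; the sign is a
  unit.\<close>

lemma overpartition_count_prime_power:
  fixes p N d e j :: nat
  assumes p: "prime p" "3 \<le> p" and N: "\<not> p dvd N" and e: "e = 2 * j + 1"
    and d: "d dvd 9" "int d dvd (\<Sum>i\<le>j. (int p ^ 3) ^ i)"
  shows "overpartition_count (3 * p ^ e * N) mod d = 0"
proof -
  define m where "m = p ^ e * N"
  have p': "prime (int p)" "int p \<noteq> 2" using p by auto
  have "\<not> int p dvd int N" using N by simp
  from card_reps_5_prime_power[OF p' this, of j]
  have "int (card (reps 5 (int m))) = int (card (reps 5 (int p * int N))) * (\<Sum>i\<le>j. (int p ^ 3) ^ i)"
    by (simp only: m_def e of_nat_mult of_nat_power)
  then have r: "int d dvd fps_nth (theta ^ 5) m" using d(2) by (simp only: card_reps_theta dvd_mult)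
  have "int d dvd 9" using d(1) int_dvd_int_iff[of d 9] by simp
  then have "int d dvd (-1) ^ m * int (overpartition_count (3 * m)) - fps_nth (theta ^ 5) m"
    using overpartition_count_cong_theta by (rule dvd_trans)
  from dvd_add[OF this r] have "int d dvd (-1) ^ m * int (overpartition_count (3 * m))"
    by (simp only: diff_add_cancel)
  then have "d dvd overpartition_count (3 * m)"
    by (simp add: minus_one_power_iff split: if_splits)
  then show ?thesis by (simp only: m_def mult.assoc mod_eq_0_iff_dvd)
qed

lemma geometric_sum_cong_1:
  fixes x m :: int
  assumes "m dvd x - 1" "m dvd int (Suc j)" shows "m dvd (\<Sum>i\<le>j. x ^ i)"
proof -
  have pow: "m dvd x ^ i - 1" for i
  proof (induction i)
    case (Suc i)
    have "x ^ Suc i - 1 = x * (x ^ i - 1) + (x - 1)" by (simp add: algebra_simps)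
    then show ?case by (simp only: dvd_add[OF dvd_mult[OF Suc.IH] assms(1)])
  qed simp
  have "(\<Sum>i\<le>j. x ^ i) = (\<Sum>i\<le>j. x ^ i - 1) + int (Suc j)" by (simp add: sum_subtractf)
  also have "m dvd \<dots>" by (intro dvd_add dvd_sum pow assms(2))
  finally show ?thesis .
qed

text \<open>The sum has an even number of terms, and consecutive ones cancel modulo
  \<open>m\<close>.\<close>

lemma geometric_sum_cong_minus_1:
  fixes x m :: int
  assumes "m dvd x + 1" shows "m dvd (\<Sum>i\<le>2 * a + 1. x ^ i)"
proof (induction a)
  case 0
  then show ?case using assms by (simp add: add.commute)
next
  case (Suc a)
  have "(\<Sum>i\<le>2 * Suc a + 1. x ^ i) = (\<Sum>i\<le>2 * a + 1. x ^ i) + x ^ (2 * a + 2) * (x + 1)"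
    by (simp add: algebra_simps)
  then show ?case by (simp only: dvd_add[OF Suc.IH dvd_mult[OF assms]])
qed

theorem theorem6:
  fixes p N \<alpha> :: nat
  assumes "prime p" and "p \<ge> 3" and "N > 0" and "coprime N p"
  shows "(p mod 3 = 1 \<longrightarrow>
            overpartition_count (3 * p ^ (6 * \<alpha> + 5) * N) mod 3 = 0 \<and>
            overpartition_count (3 * p ^ (18 * \<alpha> + 17) * N) mod 9 = 0)
       \<and> (p mod 3 = 2 \<longrightarrow>
            overpartition_count (3 * p ^ (4 * \<alpha> + 3) * N) mod 9 = 0)"
proof (intro conjI impI)
  have N: "\<not> p dvd N"
    using assms(1,4) by (metis coprime_absorb_right coprime_commute not_prime_unit)
  note cong = overpartition_count_prime_power[OF assms(1,2) N]
  {
    assume "p mod 3 = 1"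
    then obtain q where q: "p = 3 * q + 1" by (metis mult_div_mod_eq)
    have "int p ^ 3 - 1 = 9 * (3 * int q ^ 3 + 3 * int q ^ 2 + int q)"
      unfolding q by (simp add: power2_eq_square power3_eq_cube algebra_simps)
    then have p9: "9 dvd int p ^ 3 - 1" by simp
    then have p3: "3 dvd int p ^ 3 - 1" by (rule dvd_trans[rotated]) simp
    \<comment> \<open>The exponents 6 \<alpha> + 5 and 18 \<alpha> + 17 are 2 j + 1 for the j whose
      j + 1 is 3 (\<alpha> + 1) and 9 (\<alpha> + 1): the number of terms in the sum is divisible by
      the modulus.\<close>
    have "int (Suc (3 * \<alpha> + 2)) = 3 * (int \<alpha> + 1)" "int (Suc (9 * \<alpha> + 8)) = 9 * (int \<alpha> + 1)" by simp_all
    then have s3: "3 dvd int (Suc (3 * \<alpha> + 2))" and s9: "9 dvd int (Suc (9 * \<alpha> + 8))"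
      by (simp_all only: dvd_triv_left)
    show "overpartition_count (3 * p ^ (6 * \<alpha> + 5) * N) mod 3 = 0"
    proof (rule cong[where j = "3 * \<alpha> + 2"])
      show "int 3 dvd (\<Sum>i\<le>3 * \<alpha> + 2. (int p ^ 3) ^ i)"
        using geometric_sum_cong_1[OF p3 s3] by (simp only: of_nat_numeral)
    qed simp_all
    show "overpartition_count (3 * p ^ (18 * \<alpha> + 17) * N) mod 9 = 0"
    proof (rule cong[where j = "9 * \<alpha> + 8"])
      show "int 9 dvd (\<Sum>i\<le>9 * \<alpha> + 8. (int p ^ 3) ^ i)"
        using geometric_sum_cong_1[OF p9 s9] by (simp only: of_nat_numeral)
    qed simp_all
  }
  assume "p mod 3 = 2"
  then obtain q where q: "p = 3 * q + 2" by (metis mult_div_mod_eq)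
  have "int p ^ 3 + 1 = 9 * (3 * int q ^ 3 + 6 * int q ^ 2 + 4 * int q + 1)"
    unfolding q by (simp add: power2_eq_square power3_eq_cube algebra_simps)
  then have p9: "9 dvd int p ^ 3 + 1" by simp
  show "overpartition_count (3 * p ^ (4 * \<alpha> + 3) * N) mod 9 = 0"
  \<comment> \<open>Here 4 \<alpha> + 3 is 2 j + 1 with j odd, so the number of terms is
    even.\<close>
  proof (rule cong[where j = "2 * \<alpha> + 1"])
    show "int 9 dvd (\<Sum>i\<le>2 * \<alpha> + 1. (int p ^ 3) ^ i)"
      using geometric_sum_cong_minus_1[OF p9, of \<alpha>] by (simp only: of_nat_numeral)
  qed simp_all
qed

end
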